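(* Let $n>3$, let $F$ be a holomorphic function of $n$ variables, and let $K$ be the $(n+1)$-by-$\binom{n+1}{2}$ submatrix of the second Jacobian matrix $\mathrm{Jac}_2(F)$ consisting of the columns $\beta_{ab}$ with $0<a\le b\le n$. Then the ideal generated by the maximal minors of $K$ is \[\mathcal{J}_1(F)^{n-2}\,\mathcal{Q}(F).\]
   Context: Let $F$ be holomorphic on an open subset of $\mathbb{C}^n$ with coordinates $x_1,\dots,x_n$. Ideals are taken in the ring of holomorphic functions on the domain of $F$. Write $f_k=\partial F/\partial x_k$ and $f_{ij}=\partial^2F/\partial x_i\partial x_j$. The second Jacobian matrix $\mathrm{Jac}_2(F)$ is the $(n+1)\times\left(n+\binom{n+1}{2}\right)$ matrix with rows labeled $\beta_0,\beta_1,\dots,\beta_n$ and columns labeled $\beta_{ij}$ for $0\le i\le j\le n$, $(i,j)\ne(0,0)$, ordered as $\beta_{01},\dots,\beta_{0n},\beta_{11},\dots,\beta_{1n},\beta_{22},\dots,\beta_{(n-1)n},\beta_{nn}$. Its entries are as follows. Row $\beta_0$: the entry in column $\beta_{0j}$ is $f_j$, in column $\beta_{ii}$ ($i\ge1$) is $\frac12 f_{ii}$, and in column $\beta_{ij}$ ($1\le i<j$) is $f_{ij}$. Row $\beta_k$ with $k\ge1$: the entry in column $\beta_{0j}$ is $0$; the entry in column $\beta_{ij}$ ($1\le i\le j$) is $f_j$ if $k=i$, is $f_i$ if $k=j$, and is $0$ otherwise. The Jacobian ideal is $\mathcal{J}_1(F)=(f_1,\dots,f_n)$. For $1\le i,j,k,l\le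 n$ put \[Q_{ij;kl}(F) = f_{ik}f_jf_l - f_{jk}f_if_l - f_{il}f_jf_k + f_{jl}f_if_k,\] and let $\mathcal{Q}(F)$ be the ideal generated by all $Q_{ij;kl}(F)$, $1\le i,j,k,l\le n$. *)

theory Defs
  imports
    "HOL-Analysis.Analysis"
    "HOL-Algebra.Ideal_Product"
    "HOL-Library.Option_ord"
begin

text \<open>
  The coordinates are indexed by a finite linearly ordered type \<open>'n\<close>, with \<open>CARD('n)\<close> for the number
  of variables. The labels \<open>0, 1, \<dots>, n\<close> are the elements of \<open>'n option\<close>: \<open>None\<close> is the label \<open>0\<close>,
  and it is the least element for the order of \<^theory>\<open>HOL-Library.Option_ord\<close>.
\<close>

definition holomorphic_several :: "(complex ^ 'n \<Rightarrow> complex) \<Rightarrow> (complex ^ 'n) set \<Rightarrow> bool" where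
  "holomorphic_several f U \<longleftrightarrow>
     (\<forall>x\<in>U. \<exists>D. (f has_derivative D) (at x within U) \<and> (\<forall>c v. D (c *s v) = c * D v))"

text \<open>
  Functions on \<open>U\<close> are represented by their extensional representatives, so that equality in
  the ring is equality on \<open>U\<close>.
\<close>

definition hol_ring :: "(complex ^ 'n) set \<Rightarrow> (complex ^ 'n \<Rightarrow> complex) ring" where
  "hol_ring U = \<lparr>carrier = {f \<in> extensional U. holomorphic_several f U},
                 mult = (\<lambda>f g. \<lambda>x\<in>U. f x * g x),
                 one = (\<lambda>x\<in>U. 1),
                 zero = (\<lambda>x\<in>U. 0),
                 add = (\<lambda>f g. \<lambda>x\<in>U. f x + g x)\<rparr>"

lemma holomorphic_several_const: "holomorphic_several (\<lambda>x. a) U"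
  unfolding holomorphic_several_def by (intro ballI exI[of _ "\<lambda>_. 0"]) auto

lemma holomorphic_several_add:
  assumes "holomorphic_several f U" "holomorphic_several g U"
  shows "holomorphic_several (\<lambda>x. f x + g x) U"
  unfolding holomorphic_several_def
proof
  fix x assume "x \<in> U"
  then obtain D E where D: "(f has_derivative D) (at x within U)" "\<And>c v. D (c *s v) = c * D v"
    and E: "(g has_derivative E) (at x within U)" "\<And>c v. E (c *s v) = c * E v"
    using assms unfolding holomorphic_several_def by metis
  show "\<exists>D. ((\<lambda>x. f x + g x) has_derivative D) (at x within U) \<and> (\<forall>c v. D (c *s v) = c * D v)"
    using has_derivative_add[OF D(1) E(1)] D(2) E(2)
    by (intro exI[of _ "\<lambda>h. D h + E h"]) (auto simp: algebra_simps)
qed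

lemma holomorphic_several_mult:
  assumes "holomorphic_several f U" "holomorphic_several g U"
  shows "holomorphic_several (\<lambda>x. f x * g x) U"
  unfolding holomorphic_several_def
proof
  fix x assume "x \<in> U"
  then obtain D E where D: "(f has_derivative D) (at x within U)" "\<And>c v. D (c *s v) = c * D v"
    and E: "(g has_derivative E) (at x within U)" "\<And>c v. E (c *s v) = c * E v"
    using assms unfolding holomorphic_several_def by metis
  show "\<exists>D. ((\<lambda>x. f x * g x) has_derivative D) (at x within U) \<and> (\<forall>c v. D (c *s v) = c * D v)"
    using has_derivative_mult[OF D(1) E(1)] D(2) E(2)
    by (intro exI[of _ "\<lambda>h. f x * E h + D h * g x"]) (auto simp: algebra_simps)
qed

lemma holomorphic_several_cong:
  assumes "\<And>x. x \<in> U \<Longrightarrow> f x = g x"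
  shows "holomorphic_several f U \<longleftrightarrow> holomorphic_several g U"
proof -
  have "(f has_derivative D) (at x within U) \<longleftrightarrow> (g has_derivative D) (at x within U)"
    if "x \<in> U" for x D
    using that assms has_derivative_transform[of x U f g D] has_derivative_transform[of x U g f D] by auto
  then show ?thesis unfolding holomorphic_several_def by blast
qed

lemma holomorphic_several_restrict [simp]:
  "holomorphic_several (restrict f U) U \<longleftrightarrow> holomorphic_several f U"
  by (rule holomorphic_several_cong) auto

lemma cring_hol_ring: "cring (hol_ring U)"
proof (intro cringI abelian_groupI comm_monoidI)
  fix f assume f: "f \<in> carrier (hol_ring U)"
  then have "holomorphic_several (\<lambda>x. (-1) * f x) U"
    by (intro holomorphic_several_mult holomorphic_several_const) (auto simp: hol_ring_def)
  then show "\<exists>g\<in>carrier (hol_ring U). g \<oplus>\<^bsub>hol_ring U\<^esub> f = \<zero>\<^bsub>hol_ring U\<^esub>"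
    by (intro bexI[of _ "\<lambda>x\<in>U. (-1) * f x"]) (auto simp: hol_ring_def)
qed (auto simp: hol_ring_def algebra_simps extensional_def restrict_def fun_eq_iff
       holomorphic_several_restrict[unfolded restrict_def] holomorphic_several_const
       holomorphic_several_add holomorphic_several_mult)

definition pderiv_at :: "'n::finite \<Rightarrow> (complex ^ 'n \<Rightarrow> complex) \<Rightarrow> complex ^ 'n \<Rightarrow> complex" where
  "pderiv_at k f x = deriv (\<lambda>t. f (x + axis k t)) 0"

definition pderiv2_at ::
    "'n::finite \<Rightarrow> 'n \<Rightarrow> (complex ^ 'n \<Rightarrow> complex) \<Rightarrow> complex ^ 'n \<Rightarrow> complex" where
  "pderiv2_at i j f = pderiv_at i (pderiv_at j f)"

text \<open>
  In the matrix \<open>jac2 F\<close> the label pair \<open>(a, b)\<close> stands for the column \<open>\<beta>\<^sub>a\<^sub>b\<close>. Only the pairs in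
  \<open>jac2_cols\<close> are columns; the values of \<open>jac2\<close> at other pairs are irrelevant.
\<close>

definition jac2_cols :: "('n::linorder option \<times> 'n option) set" where
  "jac2_cols = {(a, b). a \<le> b \<and> (a, b) \<noteq> (None, None)}"

fun jac2 :: "(complex ^ 'n \<Rightarrow> complex) \<Rightarrow> 'n::finite option \<Rightarrow> 'n option \<times> 'n option \<Rightarrow>
    complex ^ 'n \<Rightarrow> complex" where
  "jac2 F None (None, Some j) x = pderiv_at j F x"
| "jac2 F None (Some i, Some j) x =
     (if i = j then 1 / 2 * pderiv2_at i i F x else pderiv2_at i j F x)"
| "jac2 F (Some k) (None, Some j) x = 0"
| "jac2 F (Some k) (Some i, Some j) x =
     (if k = i then pderiv_at j F x else if k = j then pderiv_at i F x else 0)"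
| "jac2 F r (a, None) x = 0"

definition K_cols :: "('n::linorder option \<times> 'n option) set" where
  "K_cols = {(a, b) \<in> jac2_cols. None < a}"

text \<open>
  Maximal minors of the matrix with rows \<open>'r\<close> and the columns in \<open>C\<close>, with at least as many columns
  as rows. The columns of a minor are taken in the order of the matrix, which is lexicographic
  in the labels.
\<close>

definition maximal_minors ::
    "(complex ^ 'n) set \<Rightarrow> ('r::{finite,linorder} \<Rightarrow> 'c::linorder \<times> 'c \<Rightarrow> complex ^ 'n \<Rightarrow> complex) \<Rightarrow>
     ('c \<times> 'c) set \<Rightarrow> (complex ^ 'n \<Rightarrow> complex) set" where
  "maximal_minors U M C =
     {\<lambda>x\<in>U. det (\<chi> r s. M r (c s) x) |c.
        range c \<subseteq> C \<and> (\<forall>s t. s < t \<longrightarrow> (c s, c t) \<in> {(a, b). a < b} <*lex*> {(a, b). a < b})}"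

definition jacobian_ideal ::
    "(complex ^ 'n::finite) set \<Rightarrow> (complex ^ 'n \<Rightarrow> complex) \<Rightarrow> (complex ^ 'n \<Rightarrow> complex) set" where
  "jacobian_ideal U F = Idl\<^bsub>hol_ring U\<^esub> (range (\<lambda>k. \<lambda>x\<in>U. pderiv_at k F x))"

definition Q_fun :: "(complex ^ 'n \<Rightarrow> complex) \<Rightarrow> 'n::finite \<Rightarrow> 'n \<Rightarrow> 'n \<Rightarrow> 'n \<Rightarrow>
    complex ^ 'n \<Rightarrow> complex" where
  "Q_fun F i j k l x =
     pderiv2_at i k F x * pderiv_at j F x * pderiv_at l F x
   - pderiv2_at j k F x * pderiv_at i F x * pderiv_at l F x
   - pderiv2_at i l F x * pderiv_at j F x * pderiv_at k F x
   + pderiv2_at j l F x * pderiv_at i F x * pderiv_at k F x"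

definition Q_ideal ::
    "(complex ^ 'n::finite) set \<Rightarrow> (complex ^ 'n \<Rightarrow> complex) \<Rightarrow> (complex ^ 'n \<Rightarrow> complex) set" where
  "Q_ideal U F = Idl\<^bsub>hol_ring U\<^esub> {\<lambda>x\<in>U. Q_fun F i j k l x |i j k l. True}"

end

(*
  Regard a choice of n+1 columns as a graph S with n+1 edges (loops allowed) on the n coordinates.
  Where no f_v vanishes, put y_ab = f_ab / (f_a f_b). Rescaling rows and columns shows that the minor
  of S is the monomial with exponents deg_S - 1 times a linear form in y with constant coefficients,
  namely the determinant whose lower rows form the unsigned incidence matrix of S and whose top row
  consists of the y_ab. Likewise Q_{ij;kl} = f_i f_j f_k f_l (y_ik - y_jk - y_il + y_jl). So one
  compares, for each degree vector, two spaces of linear forms in y.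

  Minors are combinations of the products: some vertex p has degree at least 3 in S, and subtracting
  multiples of the lower rows turns the top row into the entries Q_{ap;bp} / (f_a f_b f_p^2).
  Leibniz' formula then leaves enough exponents to clear the denominators.

  Products are combinations of minors: if S consists of an edge ab and a tree-like graph of edges
  (v, g v) in which a leads to a loop p and b to a loop q, Cramer's rule evaluates the linear form of
  S to a nonzero multiple of y_ab - y_ap - y_bq + (y_pp + y_qq) / 2, and these forms generate
  all the required ones.

  The identities extend to points where some f_v vanishes by continuity.
*)
theory Submission
  imports Defs "HOL-Complex_Analysis.Cauchy_Integral_Formula"
begin

section \<open>Partial derivatives of holomorphic functions\<close>

lemma norm_axis_complex [simp]: "norm (axis k c :: complex ^ 'n::finite) = norm c"
proof -
  have "(norm (axis k c $ i))\<^sup>2 = (if i = k then (norm c)\<^sup>2 else 0)" for i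
    by (simp add: axis_def)
  then show ?thesis by (simp add: norm_vec_def L2_set_def)
qed

lemma bounded_linear_axis: "bounded_linear (axis k :: complex \<Rightarrow> complex ^ 'n::finite)"
proof (rule bounded_linear_intro[where K=1])
  show "norm (axis k x :: complex ^ 'n) \<le> norm x * 1" for x by simp
qed (simp_all add: axis_def vec_eq_iff)

lemma axis_has_derivative:
  "((\<lambda>t. x + axis k t :: complex ^ 'n::finite) has_derivative axis k) (at c within S)"
proof -
  from bounded_linear.has_derivative[OF bounded_linear_axis has_derivative_ident[of "at c within S"]]
  show ?thesis by (auto intro!: derivative_eq_intros)
qed

lemmas continuous_on_axis [continuous_intros] = bounded_linear.continuous_on[OF bounded_linear_axis]

lemma holomorphic_several_continuous:
  assumes "holomorphic_several F U"
  shows "continuous_on U F"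
  unfolding continuous_on_eq_continuous_within
proof
  fix x assume "x \<in> U"
  then obtain D where "(F has_derivative D) (at x within U)"
    using assms unfolding holomorphic_several_def by auto
  then show "continuous (at x within U) F" by (rule has_derivative_continuous)
qed

lemma holomorphic_several_along_axis:
  fixes F :: "complex ^ 'n::finite \<Rightarrow> complex"
  assumes "open U" "holomorphic_several F U" "x + axis k c \<in> U"
  obtains D where "(F has_derivative D) (at (x + axis k c))" "\<And>c v. D (c *s v) = c * D v"
    "((\<lambda>t. F (x + axis k t)) has_field_derivative D (axis k 1)) (at c)"
proof -
  obtain D where D: "(F has_derivative D) (at (x + axis k c))" "\<And>c v. D (c *s v) = c * D v"
    using assms unfolding holomorphic_several_def by (metis at_within_open)
  have "((\<lambda>t. F (x + axis k t)) has_derivative (\<lambda>h. D (axis k h))) (at c)"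
    using has_derivative_compose[OF axis_has_derivative D(1)] .
  moreover have "(\<lambda>h. D (axis k h)) = (*) (D (axis k 1))"
  proof
    fix h :: complex
    have "axis k h = h *s (axis k 1 :: complex ^ 'n)" by (simp add: axis_def vec_eq_iff)
    then show "D (axis k h) = D (axis k 1) * h" by (simp only: D(2) mult.commute)
  qed
  ultimately have "((\<lambda>t. F (x + axis k t)) has_field_derivative D (axis k 1)) (at c)"
    unfolding has_field_derivative_def by simp
  then show ?thesis by (rule that[OF D])
qed

text \<open>The differential is complex-linear, so it is determined by its values on the axis
  vectors, and those are the partial derivatives.\<close>

lemma has_derivative_pderiv_at:
  assumes "open U" "holomorphic_several F U" "x \<in> U"
  shows "(F has_derivative (\<lambda>h. \<Sum>j\<in>UNIV. h $ j * pderiv_at j F x)) (at x)"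
proof -
  obtain D where D: "(F has_derivative D) (at x)" "\<And>c v. D (c *s v) = c * D v"
    using assms unfolding holomorphic_several_def by (metis at_within_open)
  have p: "pderiv_at j F x = D (axis j 1)" for j
  proof -
    have "x + axis j 0 \<in> U" using assms(3) by (simp add: axis_def zero_vec_def[symmetric])
    then obtain D' where D': "(F has_derivative D') (at (x + axis j 0))"
       "((\<lambda>t. F (x + axis j t)) has_field_derivative D' (axis j 1)) (at 0)"
      using holomorphic_several_along_axis[OF assms(1,2)] by metis
    have "x + axis j 0 = x" by (simp add: axis_def zero_vec_def[symmetric])
    then have "D' = D" using D' D has_derivative_unique by metis
    with D'(2) show ?thesis by (simp add: pderiv_at_def DERIV_imp_deriv)
  qed
  interpret D: linear D using D(1) has_derivative_linear by blast
  have "D h = (\<Sum>j\<in>UNIV. h $ j * pderiv_at j F x)" for h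
  proof -
    have "D h = D (\<Sum>j\<in>UNIV. h $ j *s axis j 1)" by (simp add: basis_expansion)
    also have "\<dots> = (\<Sum>j\<in>UNIV. h $ j * D (axis j 1))" by (simp add: D.sum D(2))
    finally show ?thesis by (simp add: p)
  qed
  then have "D = (\<lambda>h. \<Sum>j\<in>UNIV. h $ j * pderiv_at j F x)" by auto
  with D(1) show ?thesis by simp
qed

section \<open>Cauchy's formula for partial derivatives\<close>

definition circ :: "real \<Rightarrow> real \<Rightarrow> complex" where
  "circ r t = of_real r * exp (2 * of_real pi * \<i> * of_real t)"

lemma norm_circ [simp]: "0 < r \<Longrightarrow> norm (circ r t) = r"
  by (simp add: circ_def norm_mult)

lemma circ_nonzero [simp]: "0 < r \<Longrightarrow> circ r t \<noteq> 0"
  by (simp add: circ_def)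

lemma continuous_on_circ [continuous_intros]:
  "continuous_on S g \<Longrightarrow> continuous_on S (\<lambda>x. circ r (g x))"
  unfolding circ_def by (intro continuous_intros)

text \<open>Cauchy's formula for the first derivative along the \<open>k\<close>-th axis. With the
  circle run over the unit interval, its velocity is \<open>2 * pi * \<i> * circ r t\<close>, which
  cancels the prefactor and one of the two powers in the denominator.\<close>

lemma pderiv_at_integral:
  assumes U: "open U" "holomorphic_several F U" and r: "0 < r"
    and x: "cball x r \<subseteq> U"
  shows "pderiv_at k F x = integral (cbox 0 1) (\<lambda>t. F (x + axis k (circ r t)) / circ r t)"
proof -
  define g where "g = (\<lambda>t. F (x + axis k t))"
  have inU: "x + axis k t \<in> U" if "norm t \<le> r" for t
    using x that by (auto simp: subset_iff dist_norm)
  have fd: "g field_differentiable at t" if "norm t \<le> r" for t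
    unfolding g_def field_differentiable_def
    using holomorphic_several_along_axis[OF U inU[OF that]] by metis
  have "g holomorphic_on cball 0 r"
    unfolding holomorphic_on_def using fd field_differentiable_at_within by (metis mem_cball_0)
  then have *: "continuous_on (cball 0 r) g" "g holomorphic_on ball 0 r"
    using holomorphic_on_imp_continuous_on holomorphic_on_subset ball_subset_cball by blast+
  have "((\<lambda>u. g u / (u - 0) ^ Suc 1) has_contour_integral
      (2 * pi * \<i>) / (fact 1) * (deriv ^^ 1) g 0) (circlepath 0 r)"
    using r by (intro Cauchy_has_contour_integral_higher_derivative_circlepath[OF *]) auto
  then have "((\<lambda>t. g (circlepath 0 r t) / (circlepath 0 r t)\<^sup>2 *
      vector_derivative (circlepath 0 r) (at t within {0..1})) has_integral
      (2 * pi * \<i>) * deriv g 0) {0..1}"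
    by (simp add: has_contour_integral_def power2_eq_square)
  moreover have "g (circlepath 0 r t) / (circlepath 0 r t)\<^sup>2 *
      vector_derivative (circlepath 0 r) (at t within {0..1}) =
      (2 * pi * \<i>) * (g (circ r t) / circ r t)" if "t \<in> {0..1}" for t
  proof -
    have "vector_derivative (circlepath 0 r) (at t within {0..1}) = 2 * pi * \<i> * circ r t"
      using that by (simp only: vector_derivative_circlepath01 atLeastAtMost_iff circ_def mult.assoc)
    moreover have "circlepath 0 r t = circ r t" by (simp add: circlepath circ_def)
    ultimately show ?thesis using r by (simp add: power2_eq_square)
  qed
  ultimately have "((\<lambda>t. (2 * pi * \<i>) * (g (circ r t) / circ r t)) has_integral
      (2 * pi * \<i>) * deriv g 0) {0..1}"
    by (rule has_integral_eq[rotated])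
  note * = has_integral_mult_right[OF this, of "inverse (2 * pi * \<i>)"]
  have "((\<lambda>t. g (circ r t) / circ r t) has_integral deriv g 0) {0..1}"
  proof -
    have "inverse c * (c * w) = w" if "c \<noteq> 0" for c w :: complex using that by simp
    from this[of "2 * pi * \<i>"] have "inverse (2 * pi * \<i>) * ((2 * pi * \<i>) * w) = w" for w :: complex
      by (metis mult_eq_0_iff of_real_eq_0_iff complex_i_not_zero pi_neq_zero zero_neq_numeral)
    then show ?thesis using * by (simp only:)
  qed
  then show ?thesis
    by (simp add: pderiv_at_def g_def integral_unique)
qed

text \<open>One radius has to serve all base points near \<open>x0\<close>, so that the integral
  formula holds there with the same circles. Half the radius of a closed ball inside
  \<open>U\<close> does.\<close>

lemma cball_margin:
  assumes "open U" "x0 \<in> U"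
  obtains r where "0 < r" "\<And>x. x \<in> ball x0 r \<Longrightarrow> cball x r \<subseteq> U"
    "\<And>x k t. x \<in> ball x0 r \<Longrightarrow> x + axis k (circ r t) \<in> (U :: (complex ^ 'n::finite) set)"
proof -
  obtain e where e: "e > 0" "cball x0 e \<subseteq> U" using assms open_contains_cball by blast
  have 1: "cball x (e/2) \<subseteq> U" if "x \<in> ball x0 (e/2)" for x
  proof
    fix y assume "y \<in> cball x (e/2)"
    then have "dist x0 y \<le> e" using that dist_triangle[of x0 y x] by (simp add: dist_commute)
    then show "y \<in> U" using e by auto
  qed
  moreover have "x + axis k (circ (e/2) t) \<in> U" if "x \<in> ball x0 (e/2)" for x k t
  proof -
    have "x + axis k (circ (e/2) t) \<in> cball x (e/2)" using e(1) by (simp add: dist_norm)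
    then show ?thesis using 1 that by blast
  qed
  ultimately show ?thesis using that[of "e/2"] e by auto
qed

text \<open>Holomorphy is pointwise differentiability here; continuity of the partial derivatives is
  read off from the Cauchy integral, and the Leibniz rule below needs it.\<close>

lemma continuous_on_pderiv_at:
  assumes U: "open U" "holomorphic_several F U"
  shows "continuous_on U (pderiv_at k F)"
proof (rule continuous_at_imp_continuous_on, rule ballI)
  fix x0 assume "x0 \<in> U"
  then obtain r where r: "0 < r" "\<And>x. x \<in> ball x0 r \<Longrightarrow> cball x r \<subseteq> U"
    "\<And>x k t. x \<in> ball x0 r \<Longrightarrow> x + axis k (circ r t) \<in> U"
    using cball_margin[OF U(1)] by blast
  have cF: "continuous_on U F" using U(2) by (rule holomorphic_several_continuous)
  have "continuous_on (ball x0 r)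
      (\<lambda>x. integral (cbox 0 1) (\<lambda>t. F (x + axis k (circ r t)) / circ r t))"
    by (rule integral_continuous_on_param)
       (auto simp: case_prod_unfold r intro!: continuous_intros continuous_on_compose2[OF cF])
  then have "continuous_on (ball x0 r) (pderiv_at k F)"
    by (rule continuous_on_eq) (simp add: pderiv_at_integral[OF U r(1) r(2)])
  then show "isCont (pderiv_at k F) x0"
    using r(1) by (simp add: continuous_on_eq_continuous_at)
qed

text \<open>
  Cauchy's formula writes a partial derivative as an integral of \<open>F\<close> over circles that do not depend
  on the base point, so it can be differentiated under the integral sign.
\<close>

lemma pderiv_at_has_derivative:
  fixes F :: "complex ^ 'n::finite \<Rightarrow> complex"
  assumes U: "open U" "holomorphic_several F U" and x0: "x0 \<in> U"
  obtains r where "0 < r" "cball x0 r \<subseteq> U"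
    "(pderiv_at k F has_derivative (\<lambda>h. \<Sum>j\<in>UNIV. h $ j *
       integral (cbox 0 1) (\<lambda>t. pderiv_at j F (x0 + axis k (circ r t)) / circ r t))) (at x0)"
proof -
  obtain r where r: "0 < r" "\<And>x. x \<in> ball x0 r \<Longrightarrow> cball x r \<subseteq> U"
    "\<And>x k t. x \<in> ball x0 r \<Longrightarrow> x + axis k (circ r t) \<in> U"
    using cball_margin[OF U(1) x0] by blast
  define B where "B = (\<lambda>j. Blinfun (\<lambda>h :: complex ^ 'n::finite. h $ j))"
  have B: "blinfun_apply (B j) h = h $ j" for j h
    unfolding B_def by (simp add: bounded_linear_Blinfun_apply bounded_linear_vec_nth)
  \<comment> \<open>\<open>fx x t\<close> is the differential of the integrand at \<open>x\<close>,
    packaged as a bounded linear map because the Leibniz rule integrates differentials.\<close>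
  define fx where "fx = (\<lambda>x t. \<Sum>j\<in>UNIV.
      blinfun_mult_right (pderiv_at j F (x + axis k (circ r t)) / circ r t) o\<^sub>L B j)"
  have fx: "blinfun_apply (fx x t) h =
      (\<Sum>j\<in>UNIV. h $ j * pderiv_at j F (x + axis k (circ r t))) / circ r t" for x t h
    by (simp add: fx_def blinfun.sum_left B mult.commute sum_divide_distrib)
  have cF: "continuous_on U F" using U(2) by (rule holomorphic_several_continuous)
  note cp = continuous_on_pderiv_at[OF U]
  have cfx: "continuous_on (ball x0 r \<times> cbox 0 1) (\<lambda>(x, t). fx x t)"
    unfolding case_prod_unfold fx_def
    by (intro continuous_intros continuous_on_compose2[OF cp] bounded_linear.continuous_on[OF bounded_linear_blinfun_mult_right])
       (auto simp: r)
  have "((\<lambda>x. integral (cbox 0 1) (\<lambda>t. F (x + axis k (circ r t)) / circ r t)) has_derivative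
      blinfun_apply (integral (cbox 0 1) (fx x0))) (at x0 within ball x0 r)"
  proof (rule leibniz_rule[OF _ _ cfx])
    fix x t assume x: "x \<in> ball x0 r" and "t \<in> cbox (0::real) 1"
    have "((\<lambda>x. x + axis k (circ r t)) has_derivative (\<lambda>h. h)) (at x within ball x0 r)"
      by (auto intro!: derivative_eq_intros)
    from has_derivative_compose[OF this has_derivative_pderiv_at[OF U r(3)[OF x]]]
    have "((\<lambda>x. F (x + axis k (circ r t))) has_derivative
        (\<lambda>h. \<Sum>j\<in>UNIV. h $ j * pderiv_at j F (x + axis k (circ r t)))) (at x within ball x0 r)" .
    then have "((\<lambda>x. F (x + axis k (circ r t)) * inverse (circ r t)) has_derivative
        (\<lambda>h. (\<Sum>j\<in>UNIV. h $ j * pderiv_at j F (x + axis k (circ r t))) * inverse (circ r t)))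
        (at x within ball x0 r)"
      by (rule has_derivative_mult_left)
    moreover have "blinfun_apply (fx x t) =
        (\<lambda>h. (\<Sum>j\<in>UNIV. h $ j * pderiv_at j F (x + axis k (circ r t))) * inverse (circ r t))"
      by (simp add: fx fun_eq_iff divide_inverse)
    ultimately show "((\<lambda>x. F (x + axis k (circ r t)) / circ r t) has_derivative blinfun_apply (fx x t))
        (at x within ball x0 r)"
      by (simp add: divide_inverse)
  next
    fix x assume "x \<in> ball x0 r"
    then show "(\<lambda>t. F (x + axis k (circ r t)) / circ r t) integrable_on cbox 0 1"
      by (intro integrable_continuous)
         (auto simp: r intro!: continuous_intros continuous_on_compose2[OF cF])
  qed (use r in auto)
  then have "((\<lambda>x. integral (cbox 0 1) (\<lambda>t. F (x + axis k (circ r t)) / circ r t)) has_derivative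
      blinfun_apply (integral (cbox 0 1) (fx x0))) (at x0)"
    using r(1) by (simp add: at_within_open[of x0 "ball x0 r"])
  then have "(pderiv_at k F has_derivative blinfun_apply (integral (cbox 0 1) (fx x0))) (at x0)"
    by (rule has_derivative_transform_within_open[where s = "ball x0 r"])
       (use r in \<open>auto simp: pderiv_at_integral[OF U r(1) r(2)]\<close>)
  moreover have "blinfun_apply (integral (cbox 0 1) (fx x0)) h = (\<Sum>j\<in>UNIV. h $ j *
       integral (cbox 0 1) (\<lambda>t. pderiv_at j F (x0 + axis k (circ r t)) / circ r t))" for h
  proof -
    have "continuous_on (cbox 0 1) (\<lambda>t. case (x0, t) of (x, t) \<Rightarrow> fx x t)"
      by (rule continuous_on_compose2[OF cfx]) (use r(1) in \<open>auto intro!: continuous_intros\<close>)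
    then have "continuous_on (cbox 0 1) (fx x0)" by simp
    then have "blinfun_apply (integral (cbox 0 1) (fx x0)) h =
        integral (cbox 0 1) (\<lambda>t. blinfun_apply (fx x0 t) h)"
      by (intro blinfun_apply_integral integrable_continuous)
    also have "\<dots> = integral (cbox 0 1) (\<lambda>t. \<Sum>j\<in>UNIV. h $ j *
        (pderiv_at j F (x0 + axis k (circ r t)) / circ r t))"
      by (simp add: fx sum_divide_distrib)
    also have "\<dots> = (\<Sum>j\<in>UNIV. integral (cbox 0 1) (\<lambda>t. h $ j *
        (pderiv_at j F (x0 + axis k (circ r t)) / circ r t)))"
      by (intro integral_sum integrable_continuous)
         (auto simp: r intro!: continuous_intros continuous_on_compose2[OF cp])
    finally show ?thesis by (simp only: integral_mult_right)
  qed
  ultimately have "(pderiv_at k F has_derivative (\<lambda>h. \<Sum>j\<in>UNIV. h $ j *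
       integral (cbox 0 1) (\<lambda>t. pderiv_at j F (x0 + axis k (circ r t)) / circ r t))) (at x0)"
    by (simp add: has_derivative_eq_rhs fun_eq_iff)
  then show ?thesis using that r by auto
qed

text \<open>The differential found above is a combination of the complex coordinates of
  \<open>h\<close>, hence complex-linear.\<close>

lemma holomorphic_several_pderiv_at:
  assumes "open U" "holomorphic_several F U"
  shows "holomorphic_several (pderiv_at k F) U"
  unfolding holomorphic_several_def
proof
  fix x assume x: "x \<in> U"
  obtain r where *: "(pderiv_at k F has_derivative (\<lambda>h. \<Sum>j\<in>UNIV. h $ j *
       integral (cbox 0 1) (\<lambda>t. pderiv_at j F (x + axis k (circ r t)) / circ r t))) (at x)"
    using pderiv_at_has_derivative[OF assms x, of k] by blast
  show "\<exists>D. (pderiv_at k F has_derivative D) (at x within U) \<and> (\<forall>c v. D (c *s v) = c * D v)"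
    by (intro exI conjI, rule has_derivative_at_withinI[OF *])
       (auto simp: sum_distrib_left mult_ac)
qed

text \<open>Differentiating the Cauchy integral of \<open>pderiv_at j F\<close> in direction
  \<open>i\<close> puts \<open>pderiv_at i F\<close> under the integral sign, and the result is the
  Cauchy integral of \<open>pderiv_at j (pderiv_at i F)\<close>.\<close>

lemma pderiv2_at_commute:
  assumes "open U" "holomorphic_several F U" "x \<in> U"
  shows "pderiv2_at i j F x = pderiv2_at j i F x"
proof -
  obtain r where r: "0 < r" "cball x r \<subseteq> U"
    and *: "(pderiv_at j F has_derivative (\<lambda>h. \<Sum>i\<in>UNIV. h $ i *
       integral (cbox 0 1) (\<lambda>t. pderiv_at i F (x + axis j (circ r t)) / circ r t))) (at x)"
    by (rule pderiv_at_has_derivative[OF assms, of j])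
  have "(pderiv_at j F has_derivative (\<lambda>h. \<Sum>i\<in>UNIV. h $ i * pderiv_at i (pderiv_at j F) x)) (at x)"
    by (rule has_derivative_pderiv_at[OF assms(1) holomorphic_several_pderiv_at[OF assms(1,2)] assms(3)])
  from has_derivative_unique[OF this *]
  have "(\<Sum>l\<in>UNIV. axis i 1 $ l * pderiv_at l (pderiv_at j F) x) = (\<Sum>l\<in>UNIV. axis i 1 $ l *
       integral (cbox 0 1) (\<lambda>t. pderiv_at l F (x + axis j (circ r t)) / circ r t))"
    by (rule fun_cong)
  then have "pderiv_at i (pderiv_at j F) x =
      integral (cbox 0 1) (\<lambda>t. pderiv_at i F (x + axis j (circ r t)) / circ r t)"
    by (simp add: axis_def if_distrib[of "\<lambda>c. c * _"] cong: if_cong)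
  also have "\<dots> = pderiv_at j (pderiv_at i F) x"
    using pderiv_at_integral[OF assms(1) holomorphic_several_pderiv_at[OF assms(1,2)] r] by simp
  finally show ?thesis by (simp add: pderiv2_at_def)
qed

section \<open>Minors and linear forms\<close>

lemma sum_UNIV_option: "(\<Sum>x\<in>UNIV. f x) = f None + (\<Sum>x\<in>UNIV. f (Some x :: 'a::finite option))"
  by (simp add: UNIV_option_conv sum.reindex)

lemma prod_UNIV_option: "(\<Prod>x\<in>UNIV. f x) = f None * (\<Prod>x\<in>UNIV. f (Some x :: 'a::finite option))"
  by (simp add: UNIV_option_conv prod.reindex)

lemma det_scale_rows_columns:
  fixes A :: "'i::finite \<Rightarrow> 'i \<Rightarrow> 'a::comm_ring_1"
  shows "det (\<chi> i j. a i * b j * A i j) = prod a UNIV * prod b UNIV * det (\<chi> i j. A i j)"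
proof -
  have "(\<Prod>i\<in>UNIV. a i * b (p i) * A i (p i)) = prod a UNIV * prod b UNIV * (\<Prod>i\<in>UNIV. A i (p i))"
    if "p permutes UNIV" for p
    using prod.permute[OF that, of b] by (simp add: prod.distrib o_def)
  then show ?thesis
    by (simp add: det_def sum_distrib_left mult_ac)
qed

text \<open>
  The column \<open>(h a b, f b e\<^sub>a + f a e\<^sub>b)\<close> is bilinear in the pair of labels; for \<open>a = b\<close> it is twice
  the column of \<open>jac2\<close>.
\<close>

fun K_entry :: "('n \<Rightarrow> complex) \<Rightarrow> ('n \<Rightarrow> 'n \<Rightarrow> complex) \<Rightarrow> 'n option \<Rightarrow> 'n \<times> 'n \<Rightarrow> complex" where
  "K_entry f h None (a, b) = h a b"
| "K_entry f h (Some k) (a, b) = (if k = a then f b else 0) + (if k = b then f a else 0)"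

text \<open>The columns are numbered by the row labels, so \<open>S\<close> lists
  \<open>CARD('n) + 1\<close> edges. Repetitions and either order of the endpoints are allowed,
  which keeps the sorting of columns out of the algebra.\<close>

definition K_det :: "('n::finite \<Rightarrow> complex) \<Rightarrow> ('n \<Rightarrow> 'n \<Rightarrow> complex) \<Rightarrow> ('n option \<Rightarrow> 'n \<times> 'n) \<Rightarrow> complex" where
  "K_det f h S = det (\<chi> r s. K_entry f h r (S s))"

text \<open>A loop counts twice, so the degrees add up to twice the number of edges.\<close>

definition edge_deg :: "('s::finite \<Rightarrow> 'n \<times> 'n) \<Rightarrow> 'n \<Rightarrow> nat" where
  "edge_deg S v = (\<Sum>s\<in>UNIV. of_bool (fst (S s) = v) + of_bool (snd (S s) = v))"

definition monom_at :: "('n::finite \<Rightarrow> complex) \<Rightarrow> ('n \<Rightarrow> nat) \<Rightarrow> complex" where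
  "monom_at f m = (\<Prod>v\<in>UNIV. f v ^ m v)"

lemma monom_at_add: "monom_at f (\<lambda>v. m v + m' v) = monom_at f m * monom_at f m'"
  by (simp add: monom_at_def power_add prod.distrib)

lemma monom_at_of_bool: "monom_at f (\<lambda>v. of_bool (a = v)) = f a"
proof -
  have "f v ^ of_bool (a = v) = (if a = v then f v else 1)" for v by simp
  then show ?thesis by (simp add: monom_at_def)
qed

lemma sum_edge_deg: "(\<Sum>v\<in>UNIV. edge_deg S v) = 2 * CARD('s)"
  for S :: "'s::finite \<Rightarrow> 'n::finite \<times> 'n"
  unfolding edge_deg_def
  by (subst sum.swap) (simp add: sum.distrib of_bool_def)

lemma prod_edges: "(\<Prod>s\<in>UNIV. f (fst (S s)) * f (snd (S s))) = monom_at f (edge_deg S)"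
proof -
  have "f (fst (S s)) * f (snd (S s)) =
      (\<Prod>v\<in>UNIV. f v ^ (of_bool (fst (S s) = v) + of_bool (snd (S s) = v)))" for s
    using monom_at_add[of f "\<lambda>v. of_bool (fst (S s) = v)" "\<lambda>v. of_bool (snd (S s) = v)"]
    by (simp add: monom_at_of_bool) (simp add: monom_at_def)
  then show ?thesis
    by (simp add: monom_at_def edge_deg_def power_sum) (rule prod.swap)
qed

text \<open>
  Dividing \<open>h a b\<close> by \<open>f a f b\<close> turns the rows \<open>Some k\<close> into a constant incidence matrix, so each
  minor is a monomial in \<open>f\<close> times a linear form in the quotients with constant coefficients.
\<close>

lemma K_det_scale:
  fixes f :: "'n::finite \<Rightarrow> complex"
  assumes f: "\<And>v. f v \<noteq> 0" and S: "\<And>v. edge_deg S v = d v + 1"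
  shows "K_det f h S = monom_at f d * K_det (\<lambda>_. 1) (\<lambda>a b. h a b / (f a * f b)) S"
proof -
  define y where "y = (\<lambda>a b. h a b / (f a * f b))"
  \<comment> \<open>The column factors \<open>f a * f b\<close> contribute the exponents
    \<open>edge_deg S\<close>; the row factors lower each exponent by one, whence the shift between
    \<open>edge_deg S\<close> and \<open>d\<close>.\<close>
  define a where "a = (\<lambda>r. case r of None \<Rightarrow> 1 | Some k \<Rightarrow> inverse (f k))"
  have "K_entry f h r (S s) = a r * (f (fst (S s)) * f (snd (S s))) * K_entry (\<lambda>_. 1) y r (S s)" for r s
    using f by (cases r; cases "S s") (auto simp: a_def y_def field_simps)
  then have "K_det f h S =
      prod a UNIV * (\<Prod>s\<in>UNIV. f (fst (S s)) * f (snd (S s))) * K_det (\<lambda>_. 1) y S"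
    unfolding K_det_def by (simp add: det_scale_rows_columns)
  also have "prod a UNIV = inverse (\<Prod>k\<in>UNIV. f k)"
    by (simp add: prod_UNIV_option a_def prod_inversef[symmetric] o_def)
  also have "(\<Prod>s\<in>UNIV. f (fst (S s)) * f (snd (S s))) = monom_at f d * (\<Prod>k\<in>UNIV. f k)"
    by (subst prod_edges) (simp add: monom_at_def S prod.distrib mult.commute)
  finally show ?thesis using f by (simp add: y_def)
qed

text \<open>The top row changes by the combination of the lower rows with coefficients
  \<open>z\<close>. In the Cramer lemma the coefficient of the top row itself is 1, so the
  determinant stays the same.\<close>

lemma K_det_subtract:
  "K_det f h S = K_det f (\<lambda>a b. h a b - (z a * f b + z b * f a)) S"
proof -
  define A where "A = (\<chi> r s. K_entry f h r (S s))"
  define x where "x = (\<chi> r. case r of None \<Rightarrow> 1 | Some k \<Rightarrow> - z k)"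
  have *: "(\<Sum>k\<in>UNIV. z k * ((if k = a then f b else 0) + (if k = b then f a else 0))) = z a * f b + z b * f a" for a b
    by (simp add: distrib_left sum.distrib if_distrib[of "\<lambda>c. _ * c"] cong: if_cong)
  have "(\<chi> r. if r = None then \<Sum>i\<in>UNIV. x $ i *s row i A else row r A) =
      (\<chi> r s. K_entry f (\<lambda>a b. h a b - (z a * f b + z b * f a)) r (S s))" (is "?L = ?R")
  proof -
    have "?L $ r $ s = ?R $ r $ s" for r s
      by (cases "S s"; cases r)
         (simp_all add: A_def x_def row_def sum_UNIV_option sum_negf * flip: *)
    then show ?thesis by (simp add: vec_eq_iff)
  qed
  then show ?thesis
    using cramer_lemma_transpose[of None x A] by (simp add: K_det_def A_def x_def)
qed

section \<open>Graphs of maps with prescribed in-degrees\<close>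

text \<open>
  The condition on \<open>z\<close> says that the graph with the edges \<open>(v, g v)\<close> has a nonsingular incidence
  matrix relative to the complement of \<open>R\<close>; it holds because all cycles of \<open>g\<close> inside \<open>R\<close> are fixed
  points.
\<close>

lemma exists_map_with_fibres:
  fixes G :: "'n::finite \<Rightarrow> nat"
  assumes "(\<Sum>v\<in>UNIV. G v) = card R"
  shows "\<exists>g. (\<forall>v. card {u \<in> R. g u = v} = G v) \<and>
    (\<forall>z :: 'n \<Rightarrow> complex. (\<forall>v. v \<notin> R \<longrightarrow> z v = 0) \<longrightarrow> (\<forall>v\<in>R. z v + z (g v) = 0) \<longrightarrow> (\<forall>v. z v = 0))"
  using finite[of R] assms
proof (induction R arbitrary: G rule: finite_remove_induct)
  case empty
  then show ?case by auto
next
  case (remove R)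
  show ?case
  proof (cases "\<exists>u\<in>R. G u = 0")
    \<comment> \<open>All values of \<open>G\<close> on \<open>R\<close> are positive and the total
      is \<open>card R\<close>, so \<open>G\<close> is the indicator of \<open>R\<close>. The
      identity then works, since \<open>z v + z v = 0\<close> forces \<open>z v = 0\<close>.\<close>
    case False
    have split: "(\<Sum>v\<in>UNIV. G v) = (\<Sum>v\<in>R. G v) + (\<Sum>v\<in>-R. G v)"
      by (subst sum.union_disjoint[symmetric]) auto
    have "(\<Sum>v\<in>R. G v) = (\<Sum>v\<in>R. (G v - 1) + 1)"
      by (rule sum.cong) (use False in auto)
    also have "\<dots> = (\<Sum>v\<in>R. G v - 1) + card R" by (simp only: sum.distrib) simp
    finally have "(\<Sum>v\<in>R. G v - 1) = 0" "(\<Sum>v\<in>-R. G v) = 0"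
      using split remove.prems by linarith+
    then have "\<forall>v\<in>R. G v = 1" "\<forall>v\<in>-R. G v = 0"
      using False by (auto simp: le_antisym)
    then have "card {u \<in> R. u = v} = G v" for v
      by (cases "v \<in> R") (auto simp: card_1_singleton_iff intro!: exI[of _ v])
    then show ?thesis by (intro exI[of _ "\<lambda>u. u"]) auto
  next
    \<comment> \<open>\<open>u\<close> becomes a leaf: no arrow ends in it, its own arrow goes to
      some \<open>w\<close> with \<open>G w\<close> positive, and the rest is built on
      \<open>R - {u}\<close> with one arrow fewer owed to \<open>w\<close>.\<close>
    case True
    then obtain u where u: "u \<in> R" "G u = 0" by auto
    have "card R \<noteq> 0" using u by auto
    then obtain w where w: "G w \<noteq> 0" using remove.prems by (metis sum.neutral)
    define G' where "G' = (\<lambda>v. if v = w then G v - 1 else G v)"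
    have "(\<Sum>v\<in>UNIV. G v) = (\<Sum>v\<in>UNIV. G' v + of_bool (v = w))"
      by (rule sum.cong) (use w in \<open>auto simp: G'_def\<close>)
    also have "\<dots> = (\<Sum>v\<in>UNIV. G' v) + 1" by (simp add: sum.distrib of_bool_def)
    finally have "(\<Sum>v\<in>UNIV. G' v) = card (R - {u})"
      using u remove.prems by simp
    from remove.IH[OF u(1) this] obtain g where
      g: "\<And>v. card {x \<in> R - {u}. g x = v} = G' v"
         "\<And>z :: 'n \<Rightarrow> complex. \<lbrakk>\<forall>v. v \<notin> R - {u} \<longrightarrow> z v = 0; \<forall>v\<in>R - {u}. z v + z (g v) = 0\<rbrakk> \<Longrightarrow> \<forall>v. z v = 0"
      by blast
    have wu: "w \<noteq> u" using u w by auto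
    have "card {x \<in> R - {u}. g x = u} = 0" using g(1)[of u] u wu by (simp add: G'_def)
    then have gu: "g x \<noteq> u" if "x \<in> R" "x \<noteq> u" for x
      using that by auto
    have 1: "card {x \<in> R. (g(u := w)) x = v} = G v" for v
    proof (cases "v = w")
      case True
      then have "{x \<in> R. (g(u := w)) x = v} = insert u {x \<in> R - {u}. g x = v}" using u by auto
      then have "card {x \<in> R. (g(u := w)) x = v} = Suc (card {x \<in> R - {u}. g x = v})" by simp
      then show ?thesis using g(1)[of v] True w by (simp add: G'_def)
    next
      case False
      then have "{x \<in> R. (g(u := w)) x = v} = {x \<in> R - {u}. g x = v}" by auto
      then show ?thesis using g(1)[of v] False by (simp add: G'_def)
    qed
    have 2: "\<forall>v. z v = 0"
      if z: "\<forall>v. v \<notin> R \<longrightarrow> z v = 0" "\<forall>v\<in>R. z v + z ((g(u := w)) v) = 0" for z :: "'n \<Rightarrow> complex"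
    proof -
      \<comment> \<open>No arrow ends in \<open>u\<close>, so clearing \<open>z\<close> at
        \<open>u\<close> leaves the other equations intact. Afterwards \<open>z w = 0\<close> and
        the equation at \<open>u\<close> give \<open>z u = 0\<close>.\<close>
      have "\<forall>v. (z(u := 0)) v = 0"
      proof (rule g(2); intro allI ballI impI)
        fix v assume v: "v \<in> R - {u}"
        then have "z v + z (g v) = 0" using z(2) by (auto dest: bspec[of R _ v])
        then show "(z(u := 0)) v + (z(u := 0)) (g v) = 0" using v gu by auto
      qed (use z in auto)
      then have "z v = 0" if "v \<noteq> u" for v using that by (metis fun_upd_apply)
      moreover have "z u + z w = 0" using z(2) u by auto
      ultimately show ?thesis using wu by (metis add.right_neutral)
    qed
    show ?thesis by (intro exI[of _ "g(u := w)"] conjI allI impI) (use 1 2 in blast)+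
  qed
qed

section \<open>Linear forms spanned by the minors of one multidegree\<close>

text \<open>
  By \<open>K_det_scale\<close>, \<open>L\<close> lies in \<open>minor_span d\<close> iff the monomial with exponents \<open>d\<close> times \<open>L\<close> is a
  constant combination of minors of the multidegree in question.
\<close>

definition minor_span :: "('n::finite \<Rightarrow> nat) \<Rightarrow> (('n \<Rightarrow> 'n \<Rightarrow> complex) \<Rightarrow> complex) \<Rightarrow> bool" where
  "minor_span d L \<longleftrightarrow> (\<exists>\<alpha>. \<forall>y. (\<forall>a b. y a b = y b a) \<longrightarrow>
     L y = (\<Sum>S | \<forall>v. edge_deg S v = d v + 1. \<alpha> S * K_det (\<lambda>_. 1) y S))"

lemma minor_span_add:
  assumes "minor_span d L" "minor_span d M"
  shows "minor_span d (\<lambda>y. L y + M y)"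
proof -
  obtain \<alpha> \<beta> where "\<forall>y. (\<forall>a b. y a b = y b a) \<longrightarrow>
     L y = (\<Sum>S | \<forall>v. edge_deg S v = d v + 1. \<alpha> S * K_det (\<lambda>_. 1) y S)"
    "\<forall>y. (\<forall>a b. y a b = y b a) \<longrightarrow>
     M y = (\<Sum>S | \<forall>v. edge_deg S v = d v + 1. \<beta> S * K_det (\<lambda>_. 1) y S)"
    using assms unfolding minor_span_def by blast
  then show ?thesis unfolding minor_span_def
    by (intro exI[of _ "\<lambda>S. \<alpha> S + \<beta> S"]) (simp add: distrib_right sum.distrib)
qed

lemma minor_span_scale:
  assumes "minor_span d L"
  shows "minor_span d (\<lambda>y. c * L y)"
proof -
  obtain \<alpha> where "\<forall>y. (\<forall>a b. y a b = y b a) \<longrightarrow>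
     L y = (\<Sum>S | \<forall>v. edge_deg S v = d v + 1. \<alpha> S * K_det (\<lambda>_. 1) y S)"
    using assms unfolding minor_span_def by blast
  then show ?thesis unfolding minor_span_def
    by (intro exI[of _ "\<lambda>S. c * \<alpha> S"]) (simp add: sum_distrib_left mult.assoc)
qed

lemma minor_span_diff:
  assumes "minor_span d L" "minor_span d M"
  shows "minor_span d (\<lambda>y. L y - M y)"
  using minor_span_add[OF assms(1) minor_span_scale[OF assms(2), of "-1"]] by simp

lemma minor_span_cong:
  assumes "minor_span d L" "\<And>y. (\<And>a b. y a b = y b a) \<Longrightarrow> L y = M y"
  shows "minor_span d M"
  using assms unfolding minor_span_def by simp

text \<open>\<open>g0\<close> prescribes the arrows leaving \<open>a\<close>, \<open>b\<close>,
  \<open>p\<close>, \<open>q\<close>, which may coincide. Hypothesis \<open>d\<close> leaves room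
  for them and for the edge \<open>ab\<close>; the remaining arrows come from
  \<open>exists_map_with_fibres\<close>.\<close>

lemma minor_span_path:
  fixes d :: "'n::finite \<Rightarrow> nat"
  assumes sum_d: "(\<Sum>v\<in>UNIV. d v) = CARD('n) + 2"
    and g0: "g0 a = p" "g0 b = q" "g0 p = p" "g0 q = q"
    and d: "\<And>v. of_bool (a = v) + of_bool (b = v) + (\<Sum>u\<in>{a, b, p, q}. of_bool (g0 u = v)) \<le> d v"
  shows "minor_span d (\<lambda>y. y a b - y a p - y b q + y p p / 2 + y q q / 2)"
proof -
  define P where "P = {a, b, p, q}"
  \<comment> \<open>\<open>G v\<close> is the number of arrows into \<open>v\<close> still owed by
    vertices outside \<open>P\<close>. The arrow leaving \<open>v\<close> accounts for the 1 in
    \<open>edge_deg S v = d v + 1\<close>.\<close>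
  define G where "G = (\<lambda>v. d v - (of_bool (a = v) + of_bool (b = v) + card {u \<in> P. g0 u = v}))"
  have G: "G v + of_bool (a = v) + of_bool (b = v) + card {u \<in> P. g0 u = v} = d v" for v
  proof -
    have "card {u \<in> P. g0 u = v} = (\<Sum>u\<in>P. of_bool (g0 u = v))"
      by (simp add: P_def Int_def)
    then show ?thesis using d[of v] by (simp add: G_def P_def)
  qed
  have "(\<Sum>v\<in>UNIV. card {u \<in> P. g0 u = v}) = card P"
  proof -
    have "(\<Sum>v\<in>UNIV. card {u \<in> P. g0 u = v}) = card (\<Union>v\<in>UNIV. {u \<in> P. g0 u = v})"
      by (rule card_UN_disjoint[symmetric]) (auto simp: P_def)
    also have "(\<Union>v\<in>UNIV. {u \<in> P. g0 u = v}) = P" by auto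
    finally show ?thesis .
  qed
  \<comment> \<open>The total \<open>CARD('n) + 2\<close> is one arrowhead per vertex plus the two
    ends of \<open>ab\<close>.\<close>
  moreover have "(\<Sum>v\<in>UNIV. G v) + 2 + (\<Sum>v\<in>UNIV. card {u \<in> P. g0 u = v}) = CARD('n) + 2"
    unfolding sum_d[symmetric] G[symmetric] sum.distrib by (simp add: of_bool_def)
  ultimately have "(\<Sum>v\<in>UNIV. G v) = card (- P)"
    by (simp add: Compl_eq_Diff_UNIV card_Diff_subset)
  from exists_map_with_fibres[OF this] obtain g1 where
    g1: "\<forall>v. card {u \<in> - P. g1 u = v} = G v"
      "\<forall>z :: 'n \<Rightarrow> complex. (\<forall>v. v \<notin> - P \<longrightarrow> z v = 0) \<longrightarrow> (\<forall>v\<in>- P. z v + z (g1 v) = 0) \<longrightarrow> (\<forall>v. z v = 0)"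
    by blast
  define g where "g = (\<lambda>u. if u \<in> P then g0 u else g1 u)"
  have gP: "g a = p" "g b = q" "g p = p" "g q = q" by (auto simp: g_def P_def g0)
  define S where "S = (\<lambda>s. case s of None \<Rightarrow> (a, b) | Some v \<Rightarrow> (v, g v))"
  have fibre: "card {u. g u = v} = card {u \<in> P. g0 u = v} + G v" for v
  proof -
    have "{u. g u = v} = {u \<in> P. g0 u = v} \<union> {u \<in> - P. g1 u = v}" by (auto simp: g_def)
    moreover have "card ({u \<in> P. g0 u = v} \<union> {u \<in> - P. g1 u = v}) =
        card {u \<in> P. g0 u = v} + card {u \<in> - P. g1 u = v}"
      by (rule card_Un_disjoint) auto
    ultimately show ?thesis using g1(1) by simp
  qed
  have deg: "edge_deg S v = d v + 1" for v
  proof -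
    have "edge_deg S v = of_bool (a = v) + of_bool (b = v) + (1 + card {u. g u = v})"
      by (simp add: edge_deg_def S_def sum_UNIV_option sum.distrib of_bool_def)
         (simp add: sum.If_cases)
    then show ?thesis using fibre[of v] G[of v] by simp
  qed
  \<comment> \<open>\<open>C\<close> is the matrix of \<open>S\<close> with its top row replaced by
    the unit vector at the column of \<open>ab\<close>.\<close>
  define C :: "complex ^ ('n option) ^ ('n option)" where
    "C = (\<chi> r s. case r of None \<Rightarrow> of_bool (s = None) | Some k \<Rightarrow> K_entry (\<lambda>_. 1) (\<lambda>_ _. 0) r (S s))"
  have *: "(\<Sum>k\<in>UNIV. ((if k = a then 1 else 0) + (if k = b then 1 else 0)) * z k) = z a + z b"
    for a b and z :: "'n \<Rightarrow> complex"
    by (simp add: distrib_right sum.distrib if_distrib[of "\<lambda>c. c * _"] cong: if_cong)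
  have CN: "(transpose C *v z) $ None = z $ None + (z $ Some a + z $ Some b)" for z
    using *[of a b "\<lambda>k. z $ Some k"]
    by (simp add: matrix_vector_mult_def transpose_def C_def S_def sum_UNIV_option)
  have CS: "(transpose C *v z) $ Some v = z $ Some v + z $ Some (g v)" for z v
    using *[of v "g v" "\<lambda>k. z $ Some k"]
    by (simp add: matrix_vector_mult_def transpose_def C_def S_def sum_UNIV_option)
  have ker: "z = 0" if z: "transpose C *v z = 0" for z
  proof -
    \<comment> \<open>The loops force \<open>z\<close> to vanish at \<open>p\<close> and
      \<open>q\<close>, hence at \<open>a\<close> and \<open>b\<close>; the choice of
      \<open>g1\<close> gives the other vertices.\<close>
    have zv: "z $ Some v + z $ Some (g v) = 0" for v using CS[of z v] z by simp
    have zp: "z $ Some p = 0" and zq: "z $ Some q = 0" using zv[of p] zv[of q] gP by auto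
    then have "z $ Some a = 0" "z $ Some b = 0" using zv[of a] zv[of b] gP by auto
    then have "\<forall>v. v \<notin> - P \<longrightarrow> z $ Some v = 0" using zp zq by (auto simp: P_def)
    moreover have "\<forall>v\<in>- P. z $ Some v + z $ Some (g1 v) = 0"
      using zv by (metis ComplD g_def)
    ultimately have S0: "z $ Some v = 0" for v using spec[OF g1(2), of "\<lambda>v. z $ Some v"] by blast
    then have "z $ None = 0" using CN[of z] z by simp
    then show ?thesis using S0 by (metis not_None_eq vec_eq_iff zero_index)
  qed
  then have "\<exists>B. B ** transpose C = mat 1" by (simp add: matrix_left_invertible_ker)
  then obtain B where B: "B ** transpose C = mat 1" by blast
  then have B': "transpose C ** B = mat 1" by (simp add: matrix_left_right_inverse)
  with B have "invertible (transpose C)" unfolding invertible_def by blast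
  then have detC: "det C \<noteq> 0" by (simp add: invertible_det_nz)
  have main: "K_det (\<lambda>_. 1) y S = (y a b - y a p - y b q + y p p / 2 + y q q / 2) * det C"
    if sym: "\<And>a b. y a b = y b a" for y
  proof -
    \<comment> \<open>\<open>z\<close> expresses the true top row \<open>w\<close> through the rows
      of \<open>C\<close>, so by Cramer the determinant is \<open>z $ None * det C\<close>.\<close>
    define w :: "complex ^ ('n option)" where "w = (\<chi> s. y (fst (S s)) (snd (S s)))"
    define z where "z = B *v w"
    have z: "transpose C *v z = w"
      by (simp add: z_def matrix_vector_mul_assoc B')
    have "(\<chi> r s. K_entry (\<lambda>_. 1) y r (S s)) =
        (\<chi> r. if r = None then \<Sum>i\<in>UNIV. z $ i *s row i C else row r C)" (is "?L = ?R")
    proof -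
      have "?L $ r $ s = ?R $ r $ s" for r s
      proof (cases r)
        case None
        have "(\<Sum>i\<in>UNIV. z $ i * C $ i $ s) = w $ s"
          unfolding z[symmetric] by (simp add: matrix_vector_mult_def transpose_def mult.commute)
        moreover have "K_entry (\<lambda>_. 1) y None (S s) = w $ s" by (cases "S s") (simp add: w_def)
        ultimately show ?thesis using None by (simp add: row_def)
      next
        case (Some k)
        then show ?thesis by (cases "S s") (simp add: row_def C_def)
      qed
      then show ?thesis by (simp add: vec_eq_iff)
    qed
    then have "K_det (\<lambda>_. 1) y S = z $ None * det C"
      by (simp add: K_det_def cramer_lemma_transpose)
    moreover have "z $ None = y a b - y a p - y b q + y p p / 2 + y q q / 2"
    proof -
      \<comment> \<open>Back substitution: the loops give \<open>z\<close> at \<open>p\<close> and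
        \<open>q\<close>, the arrows from \<open>a\<close> and \<open>b\<close> give it there, and
        the column of \<open>ab\<close> leaves \<open>z $ None\<close>.\<close>
      have zv: "z $ Some v + z $ Some (g v) = y v (g v)" for v
        using CS[of z v] z by (simp add: w_def S_def)
      have "z $ Some p = y p p / 2" "z $ Some q = y q q / 2"
        using zv[of p] zv[of q] gP by (auto simp: field_simps)
      moreover have "z $ Some a = y a p - z $ Some p" "z $ Some b = y b q - z $ Some q"
        using zv[of a] zv[of b] gP by (auto simp: algebra_simps)
      moreover have "z $ None = y a b - (z $ Some a + z $ Some b)"
        using CN[of z] z by (simp add: w_def S_def algebra_simps)
      ultimately show ?thesis by (simp only:) (simp add: field_simps)
    qed
    ultimately show ?thesis by simp
  qed
  show ?thesis
    unfolding minor_span_def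
  proof (intro exI[of _ "\<lambda>T. if T = S then 1 / det C else 0"] allI impI)
    fix y :: "'n \<Rightarrow> 'n \<Rightarrow> complex" assume "\<forall>a b. y a b = y b a"
    then have "K_det (\<lambda>_. 1) y S = (y a b - y a p - y b q + y p p / 2 + y q q / 2) * det C"
      using main by blast
    then show "y a b - y a p - y b q + y p p / 2 + y q q / 2 =
        (\<Sum>T | \<forall>v. edge_deg T v = d v + 1. (if T = S then 1 / det C else 0) * K_det (\<lambda>_. 1) y T)"
      using detC deg by (simp add: if_distrib[of "\<lambda>c. c * _"] cong: if_cong)
  qed
qed

text \<open>Take \<open>p\<close> with \<open>d p\<close> largest. Terms involving \<open>p\<close>
  cancel in the alternating sum over the four pairs, so the forms of single pairs relative to
  \<open>p\<close> suffice.\<close>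

lemma minor_span_Q:
  fixes d :: "'n::finite \<Rightarrow> nat"
  assumes sum_d: "(\<Sum>v\<in>UNIV. d v) = CARD('n) + 2"
    and d: "\<And>v. of_bool (i = v) + of_bool (j = v) + of_bool (k = v) + of_bool (l = v) \<le> d v"
  shows "minor_span d (\<lambda>y. y i k - y j k - y i l + y j l)"
proof -
  obtain p where p: "\<And>v. d v \<le> d p"
  proof -
    have "Max (range d) \<in> range d" by (rule Max_in) auto
    then obtain p where "Max (range d) = d p" by (elim imageE)
    then show ?thesis using that Max_ge[of "range d"] by (metis finite finite_imageI rangeI)
  qed
  have dp: "2 \<le> d p"
  proof (rule ccontr)
    assume "\<not> 2 \<le> d p"
    then have "d v \<le> 1" for v using p[of v] by linarith
    then have "(\<Sum>v\<in>UNIV. d v) \<le> (\<Sum>v\<in>(UNIV::'n set). 1)" by (intro sum_mono) auto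
    then show False using sum_d by simp
  qed
  note path = minor_span_path[OF sum_d]
  \<comment> \<open>The form of \<open>a, b\<close> relative to the base point \<open>p\<close> is \<open>y a b - y a p - y b p + y p p\<close>. Only
    \<open>d p = 2\<close> with \<open>a \<noteq> b\<close> needs a second vertex \<open>q\<close> of multiplicity two.\<close>
  have same: "minor_span d (\<lambda>y. y a a - 2 * y a p + y p p)" if a: "a \<noteq> p" "2 \<le> d a" for a
  proof -
    have "minor_span d (\<lambda>y. y a a - y a p - y a p + y p p / 2 + y p p / 2)"
      by (rule path[of "\<lambda>_. p"]) (use a dp in \<open>auto simp: sum.insert_if simp del: sum_of_bool_eq\<close>)
    then show ?thesis by (rule minor_span_cong) (simp add: field_simps)
  qed
  \<comment> \<open>The arrows from \<open>a\<close>, \<open>b\<close> and \<open>p\<close> all end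
    in \<open>p\<close>, which needs \<open>3 <= d p\<close>.\<close>
  have large: "minor_span d (\<lambda>y. y a b - y a p - y b p + y p p)"
    if a: "a \<noteq> p" "b \<noteq> p" "a \<noteq> b" "1 \<le> d a" "1 \<le> d b" "3 \<le> d p" for a b
  proof -
    have "minor_span d (\<lambda>y. y a b - y a p - y b p + y p p / 2 + y p p / 2)"
      by (rule path[of "\<lambda>_. p"]) (use a in \<open>auto simp: sum.insert_if simp del: sum_of_bool_eq\<close>)
    then show ?thesis by (rule minor_span_cong) (simp add: field_simps)
  qed
  \<comment> \<open>The graph has the edge \<open>aq\<close>, an arrow from \<open>a\<close> to
    \<open>p\<close> and loops at \<open>p\<close> and \<open>q\<close>; half of the form
    \<open>same\<close> for \<open>q\<close> then removes \<open>y q q\<close>.\<close>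
  have double: "minor_span d (\<lambda>y. y a q - y a p - y q p + y p p)"
    if a: "a \<noteq> p" "q \<noteq> p" "a \<noteq> q" "1 \<le> d a" "2 \<le> d q" for a q
  proof -
    have "minor_span d (\<lambda>y. y a q - y a p - y q q + y p p / 2 + y q q / 2)"
      by (rule path[of "\<lambda>u. if u = q then q else p"])
         (use a dp in \<open>auto simp: sum.insert_if simp del: sum_of_bool_eq\<close>)
    from minor_span_add[OF this minor_span_scale[OF same[OF a(2,5)], of "1/2"]]
    show ?thesis by (rule minor_span_cong) (simp add: field_simps)
  qed
  \<comment> \<open>Arrows run from \<open>a\<close> to \<open>p\<close> and from \<open>b\<close>
    to \<open>q\<close>, with loops at \<open>p\<close> and \<open>q\<close>; \<open>double\<close>
    and \<open>same\<close> then move the base point of \<open>b\<close> from \<open>q\<close> to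
    \<open>p\<close>.\<close>
  have distinct: "minor_span d (\<lambda>y. y a b - y a p - y b p + y p p)"
    if a: "a \<noteq> p" "b \<noteq> p" "q \<noteq> p" "a \<noteq> b" "a \<noteq> q" "b \<noteq> q" "1 \<le> d a" "1 \<le> d b" "2 \<le> d q" for a b q
  proof -
    have "minor_span d (\<lambda>y. y a b - y a p - y b q + y p p / 2 + y q q / 2)"
      by (rule path[of "\<lambda>u. if u = q \<or> u = b then q else p"])
         (use a dp in \<open>auto simp: sum.insert_if simp del: sum_of_bool_eq\<close>)
    from minor_span_diff[OF minor_span_add[OF this double[of b q]] minor_span_scale[OF same[of q], of "1/2"]]
    show ?thesis using a by (rule_tac minor_span_cong) (auto simp: field_simps)
  qed
  have base: "minor_span d (\<lambda>y. y a b - y a p - y b p + y p p)"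
    if ab: "1 \<le> d a" "1 \<le> d b" "a = b \<Longrightarrow> 2 \<le> d a" for a b
  proof (cases "a = p \<or> b = p")
    case True
    have "minor_span d (\<lambda>y. 0)"
      unfolding minor_span_def by (intro exI[of _ "\<lambda>_. 0"]) simp
    then show ?thesis by (rule minor_span_cong) (use True in auto)
  next
    case False
    consider "a = b" | "3 \<le> d p" "a \<noteq> b" | "d p < 3" "a \<noteq> b" by linarith
    then show ?thesis
    proof cases
      case 1
      then show ?thesis using same[of a] False ab by (auto intro: minor_span_cong)
    next
      case 2
      then show ?thesis using large False ab by blast
    next
      case 3
      \<comment> \<open>Here 2 is the largest multiplicity, so a total of
        \<open>CARD('n) + 2\<close> needs a second vertex attaining it.\<close>
      obtain q where q: "q \<noteq> p" "2 \<le> d q"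
      proof (rule ccontr)
        assume "\<not> thesis"
        then have "d v \<le> 1 + of_bool (v = p)" for v using that[of v] 3 by (cases "v = p"; cases "2 \<le> d v") auto
        then have "(\<Sum>v\<in>UNIV. d v) \<le> (\<Sum>v\<in>(UNIV::'n set). 1 + of_bool (v = p))" by (intro sum_mono) auto
        also have "\<dots> = CARD('n) + 1" by (simp only: sum.distrib of_bool_def) simp
        finally show False using sum_d by simp
      qed
      consider "b = q" | "a = q" | "a \<noteq> q" "b \<noteq> q" by blast
      then show ?thesis
      proof cases
        case 1
        then show ?thesis using double[of a q] q False ab 3 by simp
      next
        case 2
        then have "minor_span d (\<lambda>y. y b a - y b p - y a p + y p p)"
          using double[of b q] q False ab 3 by simp
        then show ?thesis by (rule minor_span_cong) (simp add: algebra_simps)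
      next
        case other: 3
        then show ?thesis using distinct[of a b q] q False ab 3 by simp
      qed
    qed
  qed
  \<comment> \<open>A coincidence such as \<open>i = k\<close> counts twice in hypothesis
    \<open>d\<close>, which gives the multiplicity two that \<open>base\<close> asks for.\<close>
  have D: "1 \<le> d i" "1 \<le> d j" "1 \<le> d k" "1 \<le> d l" "i = k \<Longrightarrow> 2 \<le> d i" "j = k \<Longrightarrow> 2 \<le> d j"
    "i = l \<Longrightarrow> 2 \<le> d i" "j = l \<Longrightarrow> 2 \<le> d j"
    using d[of i] d[of j] d[of k] d[of l] by (auto simp: of_bool_def split: if_splits)
  let ?r = "\<lambda>a b y. y a b - y a p - y b p + y p p"
  have "minor_span d (\<lambda>y. ?r i k y - ?r j k y - ?r i l y + ?r j l y)"
    by (intro minor_span_add minor_span_diff base) (use D in auto)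
  then show ?thesis by (rule minor_span_cong) simp
qed

section \<open>Monomials times Q as combinations of minors\<close>

definition Q_poly :: "('n \<Rightarrow> complex) \<Rightarrow> ('n \<Rightarrow> 'n \<Rightarrow> complex) \<Rightarrow> 'n \<Rightarrow> 'n \<Rightarrow> 'n \<Rightarrow> 'n \<Rightarrow> complex" where
  "Q_poly f h i j k l = h i k * f j * f l - h j k * f i * f l - h i l * f j * f k + h j l * f i * f k"

text \<open>For small nonzero \<open>t\<close> no \<open>f v + t\<close> vanishes, so continuity
  along this one shift suffices.\<close>

lemma eq_of_eq_nonzero:
  fixes X Y :: "('n::finite \<Rightarrow> complex) \<Rightarrow> complex"
  assumes X: "\<And>f. continuous_on UNIV (\<lambda>t. X (\<lambda>v. f v + t))"
    and Y: "\<And>f. continuous_on UNIV (\<lambda>t. Y (\<lambda>v. f v + t))"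
    and eq: "\<And>f. (\<And>v. f v \<noteq> 0) \<Longrightarrow> X f = Y f"
  shows "X f = Y f"
proof -
  have *: "((\<lambda>t. Z (\<lambda>v. f v + t)) \<longlongrightarrow> Z f) (at 0)"
    if "continuous_on UNIV (\<lambda>t. Z (\<lambda>v. f v + t))" for Z :: "('n \<Rightarrow> complex) \<Rightarrow> complex"
    using that by (simp add: continuous_on_eq_continuous_at isCont_def) (drule spec[of _ 0], simp)
  have "\<forall>\<^sub>F t in at 0. \<forall>v. t \<noteq> - f v"
    by (intro eventually_all_finite eventually_neq_at_within)
  then have "\<forall>\<^sub>F t in at 0. X (\<lambda>v. f v + t) = Y (\<lambda>v. f v + t)"
  proof eventually_elim
    case (elim t)
    then have "f v + t \<noteq> 0" for v by (metis add_eq_0_iff)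
    then show ?case by (intro eq) auto
  qed
  then have "((\<lambda>t. Y (\<lambda>v. f v + t)) \<longlongrightarrow> X f) (at 0)"
    using *[OF X] by (rule Lim_transform_eventually[rotated])
  from tendsto_unique[OF at_neq_bot this *[OF Y]] show ?thesis .
qed

lemma continuous_on_K_det [continuous_intros]:
  "continuous_on UNIV (\<lambda>t. K_det (\<lambda>v. f v + t) h S)"
proof -
  have "continuous_on UNIV (\<lambda>t. K_entry (\<lambda>v. f v + t) h r e)" for r e
  proof -
    have *: "continuous_on UNIV (\<lambda>t. if b then g t else 0)" if "continuous_on UNIV g"
      for b and g :: "complex \<Rightarrow> complex"
      using that by (cases b) auto
    show ?thesis by (cases r; cases e) (auto intro!: continuous_intros *)
  qed
  then show ?thesis unfolding K_det_def det_def by (simp only: vec_lambda_beta) (intro continuous_intros)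
qed

text \<open>\<open>\<alpha>\<close> is chosen before \<open>f\<close> and \<open>h\<close>: the
  pointwise identity thereby becomes one between functions with constant coefficients.\<close>

lemma monom_at_mult_Q_eq_sum_K_det:
  fixes m :: "'n::finite \<Rightarrow> nat"
  assumes m: "(\<Sum>v\<in>UNIV. m v) + 2 = CARD('n)"
  shows "\<exists>\<alpha>. \<forall>f h. (\<forall>a b. h a b = h b a) \<longrightarrow>
    monom_at f m * Q_poly f h i j k l = (\<Sum>S\<in>UNIV. \<alpha> S * K_det f h S)"
proof -
  \<comment> \<open>\<open>Q_poly\<close> is \<open>f i * f j * f k * f l\<close> times a linear
    form in the quotients, so these four exponents are added to \<open>m\<close>.\<close>
  define d where "d = (\<lambda>v. m v + (of_bool (i = v) + of_bool (j = v) + of_bool (k = v) + of_bool (l = v)))"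
  have "(\<Sum>v\<in>UNIV. d v) = CARD('n) + 2"
    using m by (simp add: d_def sum.distrib of_bool_def)
  then have "minor_span d (\<lambda>y. y i k - y j k - y i l + y j l)"
    by (rule minor_span_Q) (simp add: d_def)
  then obtain \<alpha> where \<alpha>: "\<And>y. (\<And>a b. y a b = y b a) \<Longrightarrow> y i k - y j k - y i l + y j l =
      (\<Sum>S | \<forall>v. edge_deg S v = d v + 1. \<alpha> S * K_det (\<lambda>_. 1) y S)"
    unfolding minor_span_def by blast
  define \<beta> where "\<beta> = (\<lambda>S. if \<forall>v. edge_deg S v = d v + 1 then \<alpha> S else 0)"
  have nz: "monom_at f m * Q_poly f h i j k l = (\<Sum>S\<in>UNIV. \<beta> S * K_det f h S)"
    if f: "\<And>v. f v \<noteq> 0" and h: "\<And>a b. h a b = h b a" for f h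
  proof -
    define y where "y = (\<lambda>a b. h a b / (f a * f b))"
    have "monom_at f d = monom_at f m * (f i * f j * f k * f l)"
      by (simp add: d_def monom_at_add monom_at_of_bool)
    then have "monom_at f m * Q_poly f h i j k l = monom_at f d * (y i k - y j k - y i l + y j l)"
      using f by (simp add: Q_poly_def y_def field_simps)
    also have "\<dots> = monom_at f d * (\<Sum>S | \<forall>v. edge_deg S v = d v + 1. \<alpha> S * K_det (\<lambda>_. 1) y S)"
      using \<alpha>[of y] h by (simp add: y_def mult.commute)
    also have "\<dots> = (\<Sum>S | \<forall>v. edge_deg S v = d v + 1. \<alpha> S * K_det f h S)"
      by (simp add: sum_distrib_left K_det_scale[OF f, where d = d and h = h] y_def mult_ac)
    also have "\<dots> = (\<Sum>S\<in>UNIV. \<beta> S * K_det f h S)"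
      by (rule sum.mono_neutral_cong_left) (auto simp: \<beta>_def)
    finally show ?thesis .
  qed
  have "monom_at f m * Q_poly f h i j k l = (\<Sum>S\<in>UNIV. \<beta> S * K_det f h S)"
    if h: "\<And>a b. h a b = h b a" for f h
  proof (rule eq_of_eq_nonzero[of "\<lambda>f. monom_at f m * Q_poly f h i j k l" "\<lambda>f. \<Sum>S\<in>UNIV. \<beta> S * K_det f h S"])
    show "continuous_on UNIV (\<lambda>t. monom_at (\<lambda>v. f v + t) m * Q_poly (\<lambda>v. f v + t) h i j k l)" for f
      unfolding monom_at_def Q_poly_def by (intro continuous_intros)
    show "continuous_on UNIV (\<lambda>t. \<Sum>S\<in>UNIV. \<beta> S * K_det (\<lambda>v. f v + t) h S)" for f
      by (intro continuous_intros)
  qed (use nz h in blast)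
  then show ?thesis by blast
qed

section \<open>Minors as combinations of monomials times Q\<close>

lemma K_entry_Some_indep: "K_entry f h (Some k) e = K_entry f h' (Some k) e"
  by (cases e) simp

lemma K_det_leibniz:
  "K_det f h S = (\<Sum>\<sigma> | \<sigma> permutes UNIV. of_int (sign \<sigma>) *
    (h (fst (S (\<sigma> None))) (snd (S (\<sigma> None))) * (\<Prod>k\<in>UNIV. K_entry f (\<lambda>_ _. 0) (Some k) (S (\<sigma> (Some k))))))"
proof -
  have "K_entry f h None e = h (fst e) (snd e)" for e by (cases e) simp
  then show ?thesis
    unfolding K_det_def det_def using K_entry_Some_indep[of f h _ _ "\<lambda>_ _. 0"]
    by (simp add: prod_UNIV_option)
qed

text \<open>\<open>p\<close>, \<open>c\<close> and \<open>m\<close> depend on \<open>S\<close>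
  alone, as constant coefficients require. The exponent sum is claimed only for
  \<open>c \<sigma> \<noteq> 0\<close>, because \<open>m\<close> is a truncated difference.\<close>

lemma K_det_eq_sum_monom_at_mult_Q:
  fixes S :: "'n::finite option \<Rightarrow> 'n \<times> 'n"
  shows "\<exists>p c m. (\<forall>\<sigma>. c \<sigma> \<noteq> 0 \<longrightarrow> (\<Sum>v\<in>UNIV. m \<sigma> v) + 2 = CARD('n)) \<and>
    (\<forall>f h. (\<forall>a b. h a b = h b a) \<longrightarrow> K_det f h S = (\<Sum>\<sigma> | \<sigma> permutes UNIV. c \<sigma> *
      (monom_at f (m \<sigma>) * Q_poly f h (fst (S (\<sigma> None))) p (snd (S (\<sigma> None))) p)))"
proof -
  have total: "(\<Sum>v\<in>UNIV. edge_deg S v) = 2 * CARD('n) + 2"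
    by (simp add: sum_edge_deg)
  obtain p where p: "3 \<le> edge_deg S p"
  proof (rule ccontr)
    assume "\<not> thesis"
    then have "edge_deg S v \<le> 2" for v using that[of v] by linarith
    then have "(\<Sum>v\<in>UNIV. edge_deg S v) \<le> (\<Sum>v\<in>(UNIV::'n set). 2)" by (intro sum_mono) auto
    then show False using total by simp
  qed
  define u where "u = (\<lambda>\<sigma>. fst (S (\<sigma> (None :: 'n option))))"
  define w where "w = (\<lambda>\<sigma>. snd (S (\<sigma> (None :: 'n option))))"
  define \<kappa> where "\<kappa> = (\<lambda>\<sigma> :: 'n option \<Rightarrow> 'n option. of_int (sign \<sigma>) *
      (\<Prod>k\<in>UNIV. K_entry (\<lambda>_. 1) (\<lambda>_ _. 0) (Some k) (S (\<sigma> (Some k)))))"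
  \<comment> \<open>Terms whose top edge meets \<open>p\<close> are dropped, since there the
    \<open>Q_poly\<close> factor is zero. Below, \<open>e\<close> holds the exponents of the
    denominator \<open>f u * f w * f p * f p\<close>.\<close>
  define c where "c = (\<lambda>\<sigma>. if \<sigma> permutes UNIV \<and> u \<sigma> \<noteq> p \<and> w \<sigma> \<noteq> p then \<kappa> \<sigma> else 0)"
  define e where "e = (\<lambda>\<sigma> v. of_bool (u \<sigma> = v) + of_bool (w \<sigma> = v) + (of_bool (p = v) + of_bool (p = v)) :: nat)"
  define m where "m = (\<lambda>\<sigma> v. edge_deg S v - 1 - e \<sigma> v)"
  have deg: "m \<sigma> v + e \<sigma> v + 1 = edge_deg S v" if c: "c \<sigma> \<noteq> 0" for \<sigma> v
  proof -
    have \<sigma>: "\<sigma> permutes UNIV" "u \<sigma> \<noteq> p" "w \<sigma> \<noteq> p" "\<kappa> \<sigma> \<noteq> 0"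
      using c by (auto simp: c_def split: if_splits)
    \<comment> \<open>In a nonzero Leibniz term each \<open>v\<close> lies on its own edge
      \<open>\<sigma> (Some v)\<close>, different from the top edge, so its degree exceeds the share
      of the top edge by at least one. At \<open>p\<close> the bound 3 covers
      \<open>e = 2\<close>.\<close>
    have "K_entry (\<lambda>_. 1) (\<lambda>_ _. 0) (Some v) (S (\<sigma> (Some v))) \<noteq> 0"
      using \<sigma>(4) by (auto simp: \<kappa>_def)
    then have inc: "v = fst (S (\<sigma> (Some v))) \<or> v = snd (S (\<sigma> (Some v)))"
      by (cases "S (\<sigma> (Some v))") (auto split: if_splits)
    have ne: "\<sigma> None \<noteq> \<sigma> (Some v)" using permutes_inj[OF \<sigma>(1)] by (auto dest: injD)
    have "(\<Sum>s\<in>{\<sigma> None, \<sigma> (Some v)}. of_bool (fst (S s) = v) + of_bool (snd (S s) = v)) \<le> edge_deg S v"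
      unfolding edge_deg_def by (rule sum_mono2) auto
    then have "of_bool (u \<sigma> = v) + of_bool (w \<sigma> = v) + 1 \<le> edge_deg S v"
      using ne inc by (auto simp: u_def w_def)
    then have "e \<sigma> v + 1 \<le> edge_deg S v"
      using p \<sigma> by (cases "v = p") (auto simp: e_def)
    then show ?thesis by (simp add: m_def)
  qed
  have msum: "(\<Sum>v\<in>UNIV. m \<sigma> v) + 2 = CARD('n)" if "c \<sigma> \<noteq> 0" for \<sigma>
  proof -
    have "(\<Sum>v\<in>UNIV. m \<sigma> v) + 4 + CARD('n) = 2 * CARD('n) + 2"
      unfolding total[symmetric] deg[OF that, symmetric] by (simp add: sum.distrib sum_Suc e_def of_bool_def)
    then show ?thesis by simp
  qed
  have nz: "K_det f h S = (\<Sum>\<sigma> | \<sigma> permutes UNIV. c \<sigma> * (monom_at f (m \<sigma>) * Q_poly f h (u \<sigma>) p (w \<sigma>) p))"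
    if f: "\<And>v. f v \<noteq> 0" and h: "\<And>a b. h a b = h b a" for f h
  proof (cases "\<exists>v. edge_deg S v = 0")
    \<comment> \<open>\<open>K_det_scale\<close> needs positive degrees; a vertex of degree 0 gives
      a zero row, and then both sides vanish.\<close>
    case True
    then obtain v where v: "edge_deg S v = 0" by blast
    then have "K_entry f h (Some v) (S s) = 0" for s
      by (cases "S s") (auto simp: edge_deg_def, (metis fst_conv snd_conv)+)
    then have "K_det f h S = 0"
      unfolding K_det_def by (intro det_zero_row[of "Some v"]) (simp add: row_def vec_eq_iff)
    moreover have "c \<sigma> = 0" for \<sigma> using deg[of \<sigma> v] v by auto
    ultimately show ?thesis by simp
  next
    case False
    define y where "y = (\<lambda>a b. h a b / (f a * f b))"
    \<comment> \<open>This choice makes the top row vanish at every edge through \<open>p\<close>.\<close>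
    define z where "z = (\<lambda>a. y a p - y p p / 2)"
    define r where "r = (\<lambda>a b. y a b - (z a + z b))"
    have r: "r a b = Q_poly f h a p b p / (f a * f b * f p * f p)" for a b
      using f[of a] f[of b] f[of p] h[of p b]
      by (simp add: r_def z_def y_def Q_poly_def field_simps)
    have "K_det f h S = monom_at f (\<lambda>v. edge_deg S v - 1) * K_det (\<lambda>_. 1) y S"
      unfolding y_def by (rule K_det_scale[OF f]) (use False in auto)
    also have "K_det (\<lambda>_. 1) y S = K_det (\<lambda>_. 1) r S"
      using K_det_subtract[of "\<lambda>_. 1" y S z] by (simp add: r_def)
    also have "\<dots> = (\<Sum>\<sigma> | \<sigma> permutes UNIV. \<kappa> \<sigma> * r (u \<sigma>) (w \<sigma>))"
      by (simp add: K_det_leibniz \<kappa>_def u_def w_def mult_ac)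
    also have "monom_at f (\<lambda>v. edge_deg S v - 1) * \<dots> =
        (\<Sum>\<sigma> | \<sigma> permutes UNIV. c \<sigma> * (monom_at f (m \<sigma>) * Q_poly f h (u \<sigma>) p (w \<sigma>) p))"
      unfolding sum_distrib_left
    proof (rule sum.cong)
      fix \<sigma> :: "'n option \<Rightarrow> 'n option" assume "\<sigma> \<in> {\<sigma>. \<sigma> permutes UNIV}"
      then have \<sigma>: "\<sigma> permutes UNIV" by simp
      show "monom_at f (\<lambda>v. edge_deg S v - 1) * (\<kappa> \<sigma> * r (u \<sigma>) (w \<sigma>)) =
          c \<sigma> * (monom_at f (m \<sigma>) * Q_poly f h (u \<sigma>) p (w \<sigma>) p)"
      proof (cases "c \<sigma> = 0")
        case True
        have "r p b = 0" "r b p = 0" for b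
          by (simp_all add: r Q_poly_def)
        then have "\<kappa> \<sigma> * r (u \<sigma>) (w \<sigma>) = 0" using True \<sigma> by (auto simp: c_def split: if_splits)
        then show ?thesis using True by simp
      next
        case nonzero: False
        then have "c \<sigma> = \<kappa> \<sigma>" by (simp add: c_def split: if_splits)
        moreover have "(\<lambda>v. edge_deg S v - 1) = (\<lambda>v. m \<sigma> v + e \<sigma> v)"
          using deg[OF nonzero] by (metis add_diff_cancel_right')
        moreover have "monom_at f (\<lambda>v. m \<sigma> v + e \<sigma> v) =
            monom_at f (m \<sigma>) * (f (u \<sigma>) * f (w \<sigma>) * f p * f p)"
          by (simp add: monom_at_add e_def monom_at_of_bool mult_ac)
        ultimately show ?thesis using f by (simp add: r)
      qed
    qed simp
    finally show ?thesis .
  qed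
  have "K_det f h S = (\<Sum>\<sigma> | \<sigma> permutes UNIV. c \<sigma> * (monom_at f (m \<sigma>) * Q_poly f h (u \<sigma>) p (w \<sigma>) p))"
    if h: "\<And>a b. h a b = h b a" for f h
  proof (rule eq_of_eq_nonzero[of "\<lambda>f. K_det f h S" "\<lambda>f. \<Sum>\<sigma> | \<sigma> permutes UNIV. c \<sigma> * (monom_at f (m \<sigma>) * Q_poly f h (u \<sigma>) p (w \<sigma>) p)"])
    show "continuous_on UNIV (\<lambda>t. \<Sum>\<sigma> | \<sigma> permutes UNIV. c \<sigma> *
        (monom_at (\<lambda>v. f v + t) (m \<sigma>) * Q_poly (\<lambda>v. f v + t) h (u \<sigma>) p (w \<sigma>) p))" for f
      unfolding monom_at_def Q_poly_def by (intro continuous_intros)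
  qed (use nz h continuous_on_K_det in blast)+
  then show ?thesis
    using msum unfolding u_def w_def by blast
qed

section \<open>Ideals of holomorphic functions\<close>

lemma (in cring) ideal_colon:
  assumes I: "ideal I R" and b: "b \<in> carrier R"
  shows "ideal {x \<in> carrier R. x \<otimes> b \<in> I} R"
proof (rule idealI)
  interpret I: ideal I R by (rule I)
  show "subgroup {x \<in> carrier R. x \<otimes> b \<in> I} (add_monoid R)"
  proof (rule group.subgroupI)
    show "{x \<in> carrier R. x \<otimes> b \<in> I} \<noteq> {}" using b by (auto intro!: exI[of _ \<zero>])
  next
    fix x assume "x \<in> {x \<in> carrier R. x \<otimes> b \<in> I}"
    then show "inv\<^bsub>add_monoid R\<^esub> x \<in> {x \<in> carrier R. x \<otimes> b \<in> I}"
      using b by (auto simp: a_inv_def[symmetric] l_minus)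
  qed (use b in \<open>auto simp: l_distr add.is_group\<close>)
qed (use b I in \<open>auto simp: m_assoc ring_axioms intro: ideal.I_l_closed\<close>,
     metis I b ideal.I_l_closed m_assoc m_comm)

text \<open>Colon ideals carry membership of products from generators to the generated ideals, first
  in the left factor and then in the right one.\<close>

lemma (in cring) ideal_prod_genideal:
  assumes A: "A \<subseteq> carrier R" and B: "B \<subseteq> carrier R"
  shows "ideal_prod R (Idl A) (Idl B) = Idl {a \<otimes> b |a b. a \<in> A \<and> b \<in> B}"
proof
  define I where "I = Idl {a \<otimes> b |a b. a \<in> A \<and> b \<in> B}"
  have AB: "{a \<otimes> b |a b. a \<in> A \<and> b \<in> B} \<subseteq> carrier R" using A B by auto
  then have I: "ideal I R" unfolding I_def by (rule genideal_ideal)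
  have iA: "ideal (Idl A) R" and iB: "ideal (Idl B) R"
    using A B by (auto intro: genideal_ideal)
  have AbI: "x \<otimes> b \<in> I" if x: "x \<in> Idl A" and b: "b \<in> B" for x b
  proof -
    have "A \<subseteq> {x \<in> carrier R. x \<otimes> b \<in> I}"
      using A b genideal_self[OF AB] unfolding I_def by blast
    then have "Idl A \<subseteq> {x \<in> carrier R. x \<otimes> b \<in> I}"
      using B b by (intro genideal_minimal ideal_colon I) auto
    then show ?thesis using x by blast
  qed
  have xy: "x \<otimes> y \<in> I" if x: "x \<in> Idl A" and y: "y \<in> Idl B" for x y
  proof -
    have xc: "x \<in> carrier R" using x iA ideal.Icarr by metis
    have "B \<subseteq> {y \<in> carrier R. y \<otimes> x \<in> I}"
    proof
      fix y assume y: "y \<in> B"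
      then have yc: "y \<in> carrier R" using B by blast
      then show "y \<in> {y \<in> carrier R. y \<otimes> x \<in> I}"
        using AbI[OF x y] by (simp add: m_comm[OF yc xc])
    qed
    then have "Idl B \<subseteq> {y \<in> carrier R. y \<otimes> x \<in> I}"
      using xc by (intro genideal_minimal ideal_colon I) auto
    then have "y \<in> carrier R" "y \<otimes> x \<in> I" using y by auto
    then show ?thesis by (simp only: m_comm[OF xc])
  qed
  show "ideal_prod R (Idl A) (Idl B) \<subseteq> Idl {a \<otimes> b |a b. a \<in> A \<and> b \<in> B}"
  proof
    fix s assume "s \<in> ideal_prod R (Idl A) (Idl B)"
    then have "s \<in> I"
    proof induction
      case (prod i j)
      then show ?case by (rule xy)
    next
      case (sum s1 s2)
      then show ?case using I by (simp add: additive_subgroup.a_closed ideal.axioms(1))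
    qed
    then show "s \<in> Idl {a \<otimes> b |a b. a \<in> A \<and> b \<in> B}" by (simp add: I_def)
  qed
  show "Idl {a \<otimes> b |a b. a \<in> A \<and> b \<in> B} \<subseteq> ideal_prod R (Idl A) (Idl B)"
    using genideal_self[OF A] genideal_self[OF B]
    by (intro genideal_minimal ideal_prod_is_ideal iA iB) (blast intro: ideal_prod.prod)
qed

section \<open>Ideals and their powers in the ring of holomorphic functions\<close>

lemma restrict_in_hol_ring [simp]:
  "restrict f U \<in> carrier (hol_ring U) \<longleftrightarrow> holomorphic_several f U"
  by (simp add: hol_ring_def)

lemma mult_hol_ring [simp]:
  "restrict f U \<otimes>\<^bsub>hol_ring U\<^esub> restrict g U = (\<lambda>x\<in>U. f x * g x)"
  by (auto simp: hol_ring_def)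

lemma add_hol_ring [simp]:
  "restrict f U \<oplus>\<^bsub>hol_ring U\<^esub> restrict g U = (\<lambda>x\<in>U. f x + g x)"
  by (auto simp: hol_ring_def)

lemma holomorphic_several_diff:
  assumes "holomorphic_several f U" "holomorphic_several g U"
  shows "holomorphic_several (\<lambda>x. f x - g x) U"
  using holomorphic_several_add[OF assms(1) holomorphic_several_mult[OF holomorphic_several_const assms(2), of "-1"]]
  by simp

lemma holomorphic_several_sum:
  assumes "\<And>a. a \<in> A \<Longrightarrow> holomorphic_several (g a) U"
  shows "holomorphic_several (\<lambda>x. \<Sum>a\<in>A. g a x) U"
  using assms
  by (induction A rule: infinite_finite_induct)
     (auto intro: holomorphic_several_const holomorphic_several_add)

lemma holomorphic_several_prod:
  assumes "\<And>a. a \<in> A \<Longrightarrow> holomorphic_several (g a) U"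
  shows "holomorphic_several (\<lambda>x. \<Prod>a\<in>A. g a x) U"
  using assms
  by (induction A rule: infinite_finite_induct)
     (auto intro: holomorphic_several_const holomorphic_several_mult)

lemma holomorphic_several_power:
  assumes "holomorphic_several g U"
  shows "holomorphic_several (\<lambda>x. g x ^ k) U"
  using assms by (induction k) (auto intro: holomorphic_several_const holomorphic_several_mult)

lemma holomorphic_several_det:
  assumes "\<And>r s. holomorphic_several (M r s) U"
  shows "holomorphic_several (\<lambda>x. det (\<chi> r s. M r s x)) U"
  unfolding det_def vec_lambda_beta
  by (intro holomorphic_several_sum holomorphic_several_mult holomorphic_several_const
      holomorphic_several_prod assms)

lemma hol_ring_ideal_mult:
  assumes "ideal I (hol_ring U)" "holomorphic_several f U" "restrict g U \<in> I"
  shows "(\<lambda>x\<in>U. f x * g x) \<in> I"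
  using ideal.I_l_closed[OF assms(1,3), of "restrict f U"] assms(2) by simp

lemma hol_ring_ideal_sum:
  assumes I: "ideal I (hol_ring U)" and g: "\<And>a. a \<in> A \<Longrightarrow> restrict (g a) U \<in> I"
  shows "(\<lambda>x\<in>U. \<Sum>a\<in>A. g a x) \<in> I"
  using g
proof (induction A rule: infinite_finite_induct)
  case (insert a A)
  have "restrict (g a) U \<oplus>\<^bsub>hol_ring U\<^esub> (\<lambda>x\<in>U. \<Sum>a\<in>A. g a x) \<in> I"
    by (rule additive_subgroup.a_closed[OF ideal.axioms(1)[OF I] insert.prems insert.IH])
       (use insert.prems in blast)+
  moreover have "restrict (g a) U \<oplus>\<^bsub>hol_ring U\<^esub> (\<lambda>x\<in>U. \<Sum>a\<in>A. g a x) = (\<lambda>x\<in>U. \<Sum>a\<in>insert a A. g a x)"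
    unfolding add_hol_ring by (rule restrict_ext) (simp add: insert.hyps)
  ultimately show ?case by (simp only:)
qed (use additive_subgroup.zero_closed[OF ideal.axioms(1)[OF I]] in \<open>simp_all add: hol_ring_def\<close>)

lemma ideals_set_pow_Suc:
  "I [^]\<^bsub>ideals_set R\<^esub> Suc k = ideal_prod R (I [^]\<^bsub>ideals_set R\<^esub> k) I"
  by (simp add: nat_pow_def ideals_set_def)

text \<open>Multiplying the monomials of degree \<open>k\<close> by the generators gives exactly
  those of degree \<open>Suc k\<close>; degree 0 gives the constant 1 and hence the unit
  ideal.\<close>

lemma pow_genideal_hol_ring:
  fixes g :: "'n::finite \<Rightarrow> complex ^ 'n \<Rightarrow> complex"
  assumes g: "\<And>v. holomorphic_several (g v) U"
  shows "Idl\<^bsub>hol_ring U\<^esub> (range (\<lambda>v. restrict (g v) U)) [^]\<^bsub>ideals_set (hol_ring U)\<^esub> k =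
    Idl\<^bsub>hol_ring U\<^esub> {\<lambda>x\<in>U. monom_at (\<lambda>v. g v x) m |m. (\<Sum>v\<in>UNIV. m v) = k}"
proof (induction k)
  interpret cring "hol_ring U" by (rule cring_hol_ring)
  case 0
  have *: "{\<lambda>x\<in>U. monom_at (\<lambda>v. g v x) m |m. (\<Sum>v\<in>UNIV. m v) = (0::nat)} = {\<one>\<^bsub>hol_ring U\<^esub>}"
    by (auto simp: monom_at_def hol_ring_def restrict_def fun_eq_iff intro!: exI[of _ "\<lambda>_. 0"])
  show ?case unfolding * genideal_one by (simp add: nat_pow_def ideals_set_def)
next
  interpret cring "hol_ring U" by (rule cring_hol_ring)
  case (Suc k)
  have hol: "holomorphic_several (\<lambda>x. monom_at (\<lambda>v. g v x) m) U" for m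
    unfolding monom_at_def by (intro holomorphic_several_prod holomorphic_several_power g)
  have monom: "monom_at f (m(v := Suc (m v))) = monom_at f m * f v" for f :: "'n \<Rightarrow> complex" and m v
  proof -
    have "m(v := Suc (m v)) = (\<lambda>w. m w + of_bool (v = w))" by auto
    then show ?thesis by (simp add: monom_at_add monom_at_of_bool)
  qed
  have "{a \<otimes>\<^bsub>hol_ring U\<^esub> b |a b. a \<in> {\<lambda>x\<in>U. monom_at (\<lambda>v. g v x) m |m. (\<Sum>v\<in>UNIV. m v) = k} \<and>
        b \<in> range (\<lambda>v. restrict (g v) U)} =
      {\<lambda>x\<in>U. monom_at (\<lambda>v. g v x) m |m. (\<Sum>v\<in>UNIV. m v) = Suc k}" (is "?L = ?R")
  proof
    show "?L \<subseteq> ?R"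
    proof
      fix a assume "a \<in> ?L"
      then obtain m v where m: "(\<Sum>v\<in>UNIV. m v) = k"
        and a: "a = (\<lambda>x\<in>U. monom_at (\<lambda>v. g v x) (m(v := Suc (m v))))"
        by (auto simp: monom)
      have "(\<Sum>w\<in>UNIV. (m(v := Suc (m v))) w) = (\<Sum>w\<in>UNIV. m w + of_bool (v = w))"
        by (rule sum.cong) auto
      also have "\<dots> = Suc k" using m by (simp add: sum.distrib of_bool_def)
      finally show "a \<in> ?R" using a by blast
    qed
    show "?R \<subseteq> ?L"
    proof
      fix a assume "a \<in> ?R"
      then obtain m where m: "(\<Sum>v\<in>UNIV. m v) = Suc k"
        and a: "a = (\<lambda>x\<in>U. monom_at (\<lambda>v. g v x) m)" by auto
      obtain v where v: "m v \<noteq> 0" using m by (metis Zero_not_Suc sum.neutral)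
      define m' where "m' = m(v := m v - 1)"
      have m': "m = m'(v := Suc (m' v))" using v by (auto simp: m'_def)
      have "(\<Sum>w\<in>UNIV. m w) = (\<Sum>w\<in>UNIV. m' w + of_bool (v = w))"
        by (rule sum.cong) (use m' in \<open>auto simp: fun_eq_iff\<close>)
      then have "(\<Sum>w\<in>UNIV. m' w) = k" using m by (simp add: sum.distrib of_bool_def)
      moreover have "a = (\<lambda>x\<in>U. monom_at (\<lambda>v. g v x) m') \<otimes>\<^bsub>hol_ring U\<^esub> restrict (g v) U"
        unfolding a by (subst m') (simp add: monom)
      ultimately show "a \<in> ?L" by blast
    qed
  qed
  moreover have "{\<lambda>x\<in>U. monom_at (\<lambda>v. g v x) m |m. (\<Sum>v\<in>UNIV. m v) = k} \<subseteq> carrier (hol_ring U)"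
    "range (\<lambda>v. restrict (g v) U) \<subseteq> carrier (hol_ring U)"
    using hol g by auto
  ultimately have "ideal_prod (hol_ring U)
      (Idl\<^bsub>hol_ring U\<^esub> {\<lambda>x\<in>U. monom_at (\<lambda>v. g v x) m |m. (\<Sum>v\<in>UNIV. m v) = k})
      (Idl\<^bsub>hol_ring U\<^esub> (range (\<lambda>v. restrict (g v) U))) =
      Idl\<^bsub>hol_ring U\<^esub> {\<lambda>x\<in>U. monom_at (\<lambda>v. g v x) m |m. (\<Sum>v\<in>UNIV. m v) = Suc k}"
    by (simp add: ideal_prod_genideal)
  then show ?case unfolding ideals_set_pow_Suc Suc.IH .
qed

section \<open>Sorting the columns of a minor\<close>

lemma exists_sorting_permutation:
  fixes key :: "'r::{finite,linorder} \<Rightarrow> 'k::linorder"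
  assumes "inj key"
  obtains \<pi> where "\<pi> permutes UNIV" "\<And>s t. s < t \<Longrightarrow> key (\<pi> s) < key (\<pi> t)"
proof -
  define xs where "xs = sorted_list_of_set (UNIV :: 'r set)"
  define ys where "ys = sorted_list_of_set (range key)"
  have xs: "sorted_wrt (<) xs" "set xs = UNIV" and ys: "sorted_wrt (<) ys" "set ys = range key"
    by (simp_all add: xs_def ys_def)
  have len: "length xs = length ys"
    using assms by (simp add: xs_def ys_def card_image)
  have "\<exists>i. i < length xs \<and> xs ! i = s" for s
    using xs(2) by (metis UNIV_I in_set_conv_nth)
  then obtain ix where ix: "\<And>s. ix s < length xs" "\<And>s. xs ! ix s = s" by metis
  have mono: "ix s < ix t" if "s < t" for s t
  proof (rule ccontr)
    assume "\<not> ix s < ix t"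
    then have "ix t = ix s \<or> ix t < ix s" by linarith
    then have "xs ! ix t \<le> xs ! ix s"
      using sorted_wrt_nth_less[OF xs(1), of "ix t" "ix s"] ix(1) by auto
    then show False using ix(2) that by simp
  qed
  have "\<exists>r. key r = ys ! ix s" for s
    using nth_mem[of "ix s" ys] ix(1) len ys(2) by auto
  \<comment> \<open>\<open>\<pi>\<close> matches positions in the sorted list of indices with
    positions in the sorted list of keys.\<close>
  then obtain \<pi> where \<pi>: "\<And>s. key (\<pi> s) = ys ! ix s" by metis
  have less: "key (\<pi> s) < key (\<pi> t)" if "s < t" for s t
    using sorted_wrt_nth_less[OF ys(1) mono[OF that]] ix(1) len by (simp add: \<pi>)
  have "inj \<pi>"
  proof (rule injI)
    fix s t assume "\<pi> s = \<pi> t"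
    then show "s = t" using less[of s t] less[of t s] by (cases s t rule: linorder_cases) auto
  qed
  then have "bij \<pi>" by (simp add: bij_def finite_UNIV_inj_surj)
  then have "\<pi> permutes UNIV" by (simp add: permutes_univ bij_iff)
  with less show ?thesis using that by blast
qed

text \<open>A pair is read as a two-digit number in base \<open>CARD('n)\<close>, so the order of
  the naturals is the lexicographic order of the columns.\<close>

definition lex_rank :: "'n::{finite,linorder} \<times> 'n \<Rightarrow> nat" where
  "lex_rank e = card {x. x < fst e} * CARD('n) + card {x. x < snd e}"

lemma lex_rank_less:
  assumes "lex_rank e \<le> lex_rank e'" "e \<noteq> e'"
  shows "fst e < fst e' \<or> fst e = fst e' \<and> snd e < snd e'"
proof -
  have mono: "card {x. x < a} < card {x. x < b}" if "a < b" for a b :: 'a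
    using that by (intro psubset_card_mono) auto
  have bound: "card {x. x < a} < CARD('a)" for a :: 'a
    by (intro psubset_card_mono) auto
  consider "fst e < fst e'" | "fst e = fst e'" | "fst e' < fst e" by (rule linorder_cases)
  then show ?thesis
  proof cases
    case 2
    have "\<not> snd e' < snd e"
      using mono[of "snd e'" "snd e"] assms(1) 2 by (auto simp: lex_rank_def)
    then show ?thesis using 2 assms(2) by (auto simp: prod_eq_iff)
  next
    case 3
    then have "Suc (card {x. x < fst e'}) * CARD('a) \<le> card {x. x < fst e} * CARD('a)"
      using mono by (intro mult_right_mono) (auto simp: Suc_le_eq)
    then show ?thesis using assms(1) bound[of "snd e'"] by (simp add: lex_rank_def)
  qed simp
qed

lemma inj_lex_rank: "inj lex_rank"
proof (rule injI, rule ccontr)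
  fix e e' :: "'n::{finite,linorder} \<times> 'n" assume "lex_rank e = lex_rank e'" "e \<noteq> e'"
  then show False using lex_rank_less[of e e'] lex_rank_less[of e' e] by auto
qed

lemma K_entry_swap:
  assumes "\<And>a b. h a b = h b a"
  shows "K_entry f h r (b, a) = K_entry f h r (a, b)"
  using assms by (cases r) auto

lemma jac2_eq_K_entry:
  "jac2 F r (Some a, Some b) x = (if a = b then 1/2 else 1) *
    K_entry (\<lambda>v. pderiv_at v F x) (\<lambda>a b. pderiv2_at a b F x) r (a, b)"
  by (cases r) auto

lemma minor_jac2_eq_K_det:
  fixes S :: "'n::{finite,linorder} option \<Rightarrow> 'n \<times> 'n"
  shows "det (\<chi> r s. jac2 F r (Some (fst (S s)), Some (snd (S s))) x) =
    (\<Prod>s\<in>UNIV. if fst (S s) = snd (S s) then 1/2 else 1) *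
    K_det (\<lambda>v. pderiv_at v F x) (\<lambda>a b. pderiv2_at a b F x) S"
  using det_scale_rows_columns[of "\<lambda>_. 1" "\<lambda>s. if fst (S s) = snd (S s) then 1/2 else 1"
      "\<lambda>r s. K_entry (\<lambda>v. pderiv_at v F x) (\<lambda>a b. pderiv2_at a b F x) r (S s)"]
  by (simp add: jac2_eq_K_entry K_det_def del: K_entry.simps)

lemma maximal_minors_K_cases:
  assumes "g \<in> maximal_minors U (jac2 F) K_cols"
  obtains S where "g = (\<lambda>x\<in>U. det (\<chi> r s. jac2 F r (Some (fst (S s)), Some (snd (S s))) x))"
proof -
  obtain c where g: "g = (\<lambda>x\<in>U. det (\<chi> r s. jac2 F r (c s) x))" and c: "range c \<subseteq> K_cols"
    using assms unfolding maximal_minors_def by blast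
  have "\<exists>ab. c s = (Some (fst ab), Some (snd ab))" for s
  proof -
    obtain a b where ab: "c s = (a, b)" by fastforce
    moreover have "c s \<in> K_cols" using c by blast
    ultimately have "None < a" "a \<le> b" by (auto simp: K_cols_def jac2_cols_def)
    then show ?thesis using ab by (cases a; cases b) auto
  qed
  then obtain S where "\<And>s. c s = (Some (fst (S s)), Some (snd (S s)))" by metis
  then show ?thesis using g that[of S] by simp
qed

text \<open>Every \<open>S\<close> reduces to a genuine minor: symmetry of the second derivatives
  orders the endpoints, repeated edges give zero, sorting costs a sign, and loops cost factors of
  two.\<close>

lemma K_det_in_minor_ideal:
  fixes S :: "'n::{finite,linorder} option \<Rightarrow> 'n \<times> 'n"
  assumes I: "ideal I (hol_ring U)" and minors: "maximal_minors U (jac2 F) K_cols \<subseteq> I"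
    and sym: "\<And>x a b. x \<in> U \<Longrightarrow> pderiv2_at a b F x = pderiv2_at b a F x"
  shows "(\<lambda>x\<in>U. K_det (\<lambda>v. pderiv_at v F x) (\<lambda>a b. pderiv2_at a b F x) S) \<in> I"
proof -
  let ?D = "\<lambda>S x. K_det (\<lambda>v. pderiv_at v F x) (\<lambda>a b. pderiv2_at a b F x) S"
  define T where "T = (\<lambda>s. (min (fst (S s)) (snd (S s)), max (fst (S s)) (snd (S s))))"
  have ST: "?D S x = ?D T x" if "x \<in> U" for x
  proof -
    have "K_entry (\<lambda>v. pderiv_at v F x) (\<lambda>a b. pderiv2_at a b F x) r (S s) =
        K_entry (\<lambda>v. pderiv_at v F x) (\<lambda>a b. pderiv2_at a b F x) r (T s)" for r s
      using K_entry_swap[of "\<lambda>a b. pderiv2_at a b F x", OF sym[OF that]]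
      by (cases "S s") (simp add: T_def min_def max_def del: K_entry.simps)
    then show ?thesis by (simp add: K_det_def)
  qed
  have "(\<lambda>x\<in>U. ?D T x) \<in> I"
  proof (cases "inj T")
    case False
    then obtain s t where st: "s \<noteq> t" "T s = T t" by (auto simp: inj_def)
    have "?D T x = 0" for x
      unfolding K_det_def using st by (intro det_identical_columns[OF st(1)]) (simp add: column_def)
    then show ?thesis
      using additive_subgroup.zero_closed[OF ideal.axioms(1)[OF I]] by (simp add: hol_ring_def)
  next
    case True
    then have "inj (\<lambda>s. lex_rank (T s))" using inj_compose[OF inj_lex_rank] by (simp add: o_def)
    then obtain \<pi> where \<pi>: "\<pi> permutes UNIV"
      and less: "\<And>s t. s < t \<Longrightarrow> lex_rank (T (\<pi> s)) < lex_rank (T (\<pi> t))"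
      using exists_sorting_permutation[of "\<lambda>s. lex_rank (T s)"] by blast
    define V where "V = (\<lambda>s. T (\<pi> s))"
    define c where "c = (\<lambda>s. (Some (fst (V s)), Some (snd (V s))))"
    have "range c \<subseteq> K_cols"
      by (auto simp: c_def V_def T_def K_cols_def jac2_cols_def min_le_iff_disj le_max_iff_disj)
    moreover have "(c s, c t) \<in> {(a, b). a < b} <*lex*> {(a, b). a < b}" if "s < t" for s t
    proof -
      have "lex_rank (V s) < lex_rank (V t)" unfolding V_def by (rule less[OF that])
      then have "fst (V s) < fst (V t) \<or> fst (V s) = fst (V t) \<and> snd (V s) < snd (V t)"
        by (intro lex_rank_less) auto
      then show ?thesis by (auto simp: c_def)
    qed
    ultimately have "(\<lambda>x\<in>U. det (\<chi> r s. jac2 F r (c s) x)) \<in> I"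
      using minors unfolding maximal_minors_def by blast
    then have minor: "(\<lambda>x\<in>U. (\<Prod>s\<in>UNIV. if fst (V s) = snd (V s) then 1/2 else 1) * ?D V x) \<in> I"
      by (simp add: c_def minor_jac2_eq_K_det)
    define \<gamma> :: complex where "\<gamma> = (\<Prod>s\<in>UNIV. if fst (V s) = snd (V s) then 1/2 else 1)"
    have \<gamma>: "\<gamma> \<noteq> 0" by (simp add: \<gamma>_def)
    have "?D V x = of_int (sign \<pi>) * ?D T x" for x
      using det_permute_columns[OF \<pi>, of "\<chi> r s. K_entry (\<lambda>v. pderiv_at v F x) (\<lambda>a b. pderiv2_at a b F x) r (T s)"]
      by (simp add: K_det_def V_def)
    \<comment> \<open>A sign is its own inverse, and \<open>\<gamma>\<close>, a power of one half,
      is a unit.\<close>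
    then have "?D T x = (of_int (sign \<pi>) / \<gamma>) * (\<gamma> * ?D V x)" for x
      using \<gamma> by (simp add: sign_def)
    then have eq: "(\<lambda>x\<in>U. ?D T x) = (\<lambda>x\<in>U. (of_int (sign \<pi>) / \<gamma>) * (\<gamma> * ?D V x))"
      by (intro restrict_ext)
    show ?thesis
      unfolding eq by (rule hol_ring_ideal_mult[OF I holomorphic_several_const minor[folded \<gamma>_def]])
  qed
  moreover have "(\<lambda>x\<in>U. ?D S x) = (\<lambda>x\<in>U. ?D T x)"
    by (rule restrict_ext) (rule ST)
  ultimately show ?thesis by simp
qed

section \<open>Equality of the two ideals\<close>

theorem mainTheorem3:
  fixes F :: "complex ^ 'n::{finite,linorder} \<Rightarrow> complex"
    and U :: "(complex ^ 'n::{finite,linorder}) set"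
  assumes "CARD('n) > 3"
    and "open U"
    and "holomorphic_several F U"
  shows "Idl\<^bsub>hol_ring U\<^esub> (maximal_minors U (jac2 F) K_cols) =
    ideal_prod (hol_ring U)
      (jacobian_ideal U F [^]\<^bsub>ideals_set (hol_ring U)\<^esub> (CARD('n) - 2))
      (Q_ideal U F)"
proof -
  interpret cring "hol_ring U" by (rule cring_hol_ring)
  define f where "f = (\<lambda>x v. pderiv_at v F x)"
  define h where "h = (\<lambda>x a b. pderiv2_at a b F x)"
  have hf: "holomorphic_several (\<lambda>x. f x v) U" for v
    unfolding f_def by (rule holomorphic_several_pderiv_at[OF assms(2,3)])
  have hh: "holomorphic_several (\<lambda>x. h x a b) U" for a b
    unfolding h_def pderiv2_at_def
    by (intro holomorphic_several_pderiv_at assms(2,3))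
  have sym: "h x a b = h x b a" if "x \<in> U" for x a b
    unfolding h_def by (rule pderiv2_at_commute[OF assms(2,3) that])
  have hm: "holomorphic_several (\<lambda>x. monom_at (f x) m) U" for m
    unfolding monom_at_def by (intro holomorphic_several_prod holomorphic_several_power hf)
  have hQ: "holomorphic_several (\<lambda>x. Q_poly (f x) (h x) i j k l) U" for i j k l
    unfolding Q_poly_def
    by (intro holomorphic_several_add holomorphic_several_diff holomorphic_several_mult hf hh)
  have hK: "holomorphic_several (\<lambda>x. K_det (f x) (h x) S) U" for S
  proof -
    have "holomorphic_several (\<lambda>x. K_entry (f x) (h x) r e) U" for r e
    proof -
      have *: "holomorphic_several (\<lambda>x. if b then g x else 0) U"
        if "holomorphic_several g U" for b g
        using that by (cases b) (auto intro: holomorphic_several_const)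
      show ?thesis by (cases r; cases e) (auto intro!: holomorphic_several_add hf hh *)
    qed
    then show ?thesis unfolding K_det_def by (rule holomorphic_several_det)
  qed
  \<comment> \<open>\<open>M\<close>, \<open>Q\<close> and \<open>MQ\<close> generate the Jacobian
    power, the ideal of the \<open>Q_fun\<close> and their product. Then \<open>MQ\<close> and
    \<open>mins\<close> are compared generator by generator.\<close>
  define M where "M = {\<lambda>x\<in>U. monom_at (f x) m |m. (\<Sum>v\<in>UNIV. m v) = CARD('n) - 2}"
  define Q where "Q = {\<lambda>x\<in>U. Q_poly (f x) (h x) i j k l |i j k l. True}"
  define MQ where "MQ = {\<lambda>x\<in>U. monom_at (f x) m * Q_poly (f x) (h x) i j k l |m i j k l.
      (\<Sum>v\<in>UNIV. m v) = CARD('n) - 2}"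
  define mins where "mins = maximal_minors U (jac2 F) K_cols"
  have carr: "M \<subseteq> carrier (hol_ring U)" "Q \<subseteq> carrier (hol_ring U)" "MQ \<subseteq> carrier (hol_ring U)"
    using hm hQ by (auto simp: M_def Q_def MQ_def intro!: holomorphic_several_mult)
  have minsc: "mins \<subseteq> carrier (hol_ring U)"
  proof
    fix g assume "g \<in> mins"
    then obtain S where "g = (\<lambda>x\<in>U. det (\<chi> r s. jac2 F r (Some (fst (S s)), Some (snd (S s))) x))"
      unfolding mins_def by (rule maximal_minors_K_cases)
    then show "g \<in> carrier (hol_ring U)"
      using holomorphic_several_mult[OF holomorphic_several_const hK]
      by (simp add: minor_jac2_eq_K_det f_def h_def)
  qed
  have iMQ: "ideal (Idl\<^bsub>hol_ring U\<^esub> MQ) (hol_ring U)" and imins: "ideal (Idl\<^bsub>hol_ring U\<^esub> mins) (hol_ring U)"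
    using carr minsc by (auto intro: genideal_ideal)
  have "jacobian_ideal U F [^]\<^bsub>ideals_set (hol_ring U)\<^esub> (CARD('n) - 2) = Idl\<^bsub>hol_ring U\<^esub> M"
    using pow_genideal_hol_ring[of "\<lambda>v x. f x v", OF hf]
    by (simp add: jacobian_ideal_def M_def f_def)
  moreover have "Q_ideal U F = Idl\<^bsub>hol_ring U\<^esub> Q"
    by (simp add: Q_ideal_def Q_def Q_fun_def Q_poly_def f_def h_def)
  moreover have "{a \<otimes>\<^bsub>hol_ring U\<^esub> b |a b. a \<in> M \<and> b \<in> Q} = MQ"
  proof (intro equalityI subsetI)
    fix g assume "g \<in> {a \<otimes>\<^bsub>hol_ring U\<^esub> b |a b. a \<in> M \<and> b \<in> Q}"
    then obtain m i j k l where "(\<Sum>v\<in>UNIV. m v) = CARD('n) - 2"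
      "g = (\<lambda>x\<in>U. monom_at (f x) m) \<otimes>\<^bsub>hol_ring U\<^esub> (\<lambda>x\<in>U. Q_poly (f x) (h x) i j k l)"
      unfolding M_def Q_def by blast
    then show "g \<in> MQ" unfolding MQ_def mult_hol_ring by blast
  next
    fix g assume "g \<in> MQ"
    then obtain m i j k l where m: "(\<Sum>v\<in>UNIV. m v) = CARD('n) - 2"
      and "g = (\<lambda>x\<in>U. monom_at (f x) m * Q_poly (f x) (h x) i j k l)"
      unfolding MQ_def by blast
    then have "g = (\<lambda>x\<in>U. monom_at (f x) m) \<otimes>\<^bsub>hol_ring U\<^esub> (\<lambda>x\<in>U. Q_poly (f x) (h x) i j k l)"
      by (simp only: mult_hol_ring)
    moreover have "(\<lambda>x\<in>U. monom_at (f x) m) \<in> M" using m unfolding M_def by blast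
    moreover have "(\<lambda>x\<in>U. Q_poly (f x) (h x) i j k l) \<in> Q" unfolding Q_def by blast
    ultimately show "g \<in> {a \<otimes>\<^bsub>hol_ring U\<^esub> b |a b. a \<in> M \<and> b \<in> Q}" by blast
  qed
  ultimately have rhs: "ideal_prod (hol_ring U)
      (jacobian_ideal U F [^]\<^bsub>ideals_set (hol_ring U)\<^esub> (CARD('n) - 2)) (Q_ideal U F) =
      Idl\<^bsub>hol_ring U\<^esub> MQ"
    using carr by (simp add: ideal_prod_genideal)
  have KI: "(\<lambda>x\<in>U. K_det (f x) (h x) S) \<in> Idl\<^bsub>hol_ring U\<^esub> MQ" for S
  proof -
    obtain p c m where c: "\<And>\<sigma>. c \<sigma> \<noteq> 0 \<Longrightarrow> (\<Sum>v\<in>UNIV. m \<sigma> v) + 2 = CARD('n)"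
      and K: "\<And>f h. (\<And>a b. h a b = h b a) \<Longrightarrow> K_det f h S = (\<Sum>\<sigma> | \<sigma> permutes UNIV. c \<sigma> *
        (monom_at f (m \<sigma>) * Q_poly f h (fst (S (\<sigma> None))) p (snd (S (\<sigma> None))) p))"
      using K_det_eq_sum_monom_at_mult_Q[of S] by blast
    have "(\<lambda>x\<in>U. c \<sigma> * (monom_at (f x) (m \<sigma>) *
        Q_poly (f x) (h x) (fst (S (\<sigma> None))) p (snd (S (\<sigma> None))) p)) \<in> Idl\<^bsub>hol_ring U\<^esub> MQ" for \<sigma>
    proof (cases "c \<sigma> = 0")
      \<comment> \<open>For a zero coefficient the exponents may have the wrong sum, but the term is
        the zero function.\<close>
      case True
      then show ?thesis
        using additive_subgroup.zero_closed[OF ideal.axioms(1)[OF iMQ]] by (simp add: hol_ring_def)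
    next
      case False
      then have "(\<Sum>v\<in>UNIV. m \<sigma> v) = CARD('n) - 2" using c[of \<sigma>] by linarith
      then have "(\<lambda>x\<in>U. monom_at (f x) (m \<sigma>) *
          Q_poly (f x) (h x) (fst (S (\<sigma> None))) p (snd (S (\<sigma> None))) p) \<in> MQ"
        unfolding MQ_def by blast
      then have "(\<lambda>x\<in>U. monom_at (f x) (m \<sigma>) *
          Q_poly (f x) (h x) (fst (S (\<sigma> None))) p (snd (S (\<sigma> None))) p) \<in> Idl\<^bsub>hol_ring U\<^esub> MQ"
        by (rule subsetD[OF genideal_self[OF carr(3)]])
      then show ?thesis by (rule hol_ring_ideal_mult[OF iMQ holomorphic_several_const])
    qed
    then have "(\<lambda>x\<in>U. \<Sum>\<sigma> | \<sigma> permutes UNIV. c \<sigma> * (monom_at (f x) (m \<sigma>) *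
        Q_poly (f x) (h x) (fst (S (\<sigma> None))) p (snd (S (\<sigma> None))) p)) \<in> Idl\<^bsub>hol_ring U\<^esub> MQ"
      by (intro hol_ring_ideal_sum[OF iMQ])
    also have "(\<lambda>x\<in>U. \<Sum>\<sigma> | \<sigma> permutes UNIV. c \<sigma> * (monom_at (f x) (m \<sigma>) *
        Q_poly (f x) (h x) (fst (S (\<sigma> None))) p (snd (S (\<sigma> None))) p)) = (\<lambda>x\<in>U. K_det (f x) (h x) S)"
      by (rule restrict_ext) (rule K[OF sym, symmetric])
    finally show ?thesis .
  qed
  have "mins \<subseteq> Idl\<^bsub>hol_ring U\<^esub> MQ"
  proof
    fix g assume "g \<in> mins"
    then obtain S where "g = (\<lambda>x\<in>U. det (\<chi> r s. jac2 F r (Some (fst (S s)), Some (snd (S s))) x))"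
      unfolding mins_def by (rule maximal_minors_K_cases)
    then show "g \<in> Idl\<^bsub>hol_ring U\<^esub> MQ"
      using hol_ring_ideal_mult[OF iMQ holomorphic_several_const KI]
      by (simp add: minor_jac2_eq_K_det f_def h_def)
  qed
  moreover have "MQ \<subseteq> Idl\<^bsub>hol_ring U\<^esub> mins"
  proof
    fix g assume "g \<in> MQ"
    then obtain m i j k l where g: "g = (\<lambda>x\<in>U. monom_at (f x) m * Q_poly (f x) (h x) i j k l)"
      and m: "(\<Sum>v\<in>UNIV. m v) = CARD('n) - 2" unfolding MQ_def by blast
    \<comment> \<open>\<open>CARD('n) > 3\<close> makes the truncated difference
      \<open>CARD('n) - 2\<close> exact.\<close>
    have "(\<Sum>v\<in>UNIV. m v) + 2 = CARD('n)" using m assms(1) by linarith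
    from monom_at_mult_Q_eq_sum_K_det[OF this] obtain \<alpha> where
      \<alpha>: "\<And>f h. (\<And>a b. h a b = h b a) \<Longrightarrow>
        monom_at f m * Q_poly f h i j k l = (\<Sum>S\<in>UNIV. \<alpha> S * K_det f h S)" by blast
    have "(\<lambda>x\<in>U. K_det (f x) (h x) S) \<in> Idl\<^bsub>hol_ring U\<^esub> mins" for S
      unfolding f_def h_def
      using genideal_self[OF minsc] sym[unfolded h_def]
      by (intro K_det_in_minor_ideal[OF imins]) (auto simp: mins_def)
    then have "(\<lambda>x\<in>U. \<Sum>S\<in>UNIV. \<alpha> S * K_det (f x) (h x) S) \<in> Idl\<^bsub>hol_ring U\<^esub> mins"
      by (intro hol_ring_ideal_sum[OF imins] hol_ring_ideal_mult[OF imins] holomorphic_several_const)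
    also have "(\<lambda>x\<in>U. \<Sum>S\<in>UNIV. \<alpha> S * K_det (f x) (h x) S) = g"
      unfolding g by (rule restrict_ext) (rule \<alpha>[OF sym, symmetric])
    finally show "g \<in> Idl\<^bsub>hol_ring U\<^esub> mins" .
  qed
  ultimately have "Idl\<^bsub>hol_ring U\<^esub> mins = Idl\<^bsub>hol_ring U\<^esub> MQ"
    using genideal_minimal[OF iMQ] genideal_minimal[OF imins] by blast
  then show ?thesis using rhs by (simp add: mins_def)
qed

end
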